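(* There is an absolute constant $C \geq 1$ such that for every $f \in BV(\mathbb{H})$, $$\|f\|_{4/3} \leq C \sqrt{\|Xf\|\,\|Yf\|}.$$
   Context: $\mathbb{H}$ is the first Heisenberg group, i.e. $\mathbb{R}^{3}$ with coordinates $(x,y,t)$ and group product $(x,y,t)\cdot(x',y',t') = (x+x',y+y',t+t'+\tfrac12(xy'-yx'))$. All integrals and $L^{p}$ norms $\|\cdot\|_{p}$ on $\mathbb{H}$ are with respect to Lebesgue measure on $\mathbb{R}^{3}$. The standard left-invariant horizontal vector fields are $X = \partial_{x} - \tfrac{y}{2}\partial_{t}$ and $Y = \partial_{y} + \tfrac{x}{2}\partial_{t}$. $BV(\mathbb{H})$ is the set of functions $f \in L^{1}(\mathbb{H})$ whose distributional derivatives $Xf$ and $Yf$ are signed Radon measures of finite total variation (so, for $Z \in \{X,Y\}$, $\int f\, Z\varphi = -\int \varphi \, d(Zf)$ for all $\varphi \in C_{c}^{\infty}(\mathbb{R}^{3})$). $\|Xf\|$ and $\|Yf\|$ denote the total variations of these measures. *)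

theory Defs
  imports "HOL-Analysis.Analysis"
begin

text \<open>Points of the Heisenberg group, in the coordinates $(x,y,t)$.\<close>

type_synonym heis = "real \<times> real \<times> real"

definition X_field :: "(heis \<Rightarrow> real) \<Rightarrow> heis \<Rightarrow> real" where
  "X_field \<phi> = (\<lambda>(x, y, t). deriv (\<lambda>s. \<phi> (s, y, t)) x - y / 2 * deriv (\<lambda>s. \<phi> (x, y, s)) t)"

definition Y_field :: "(heis \<Rightarrow> real) \<Rightarrow> heis \<Rightarrow> real" where
  "Y_field \<phi> = (\<lambda>(x, y, t). deriv (\<lambda>s. \<phi> (x, s, t)) y + x / 2 * deriv (\<lambda>s. \<phi> (x, y, s)) t)"

primrec C_k :: "nat \<Rightarrow> ('a::euclidean_space \<Rightarrow> real) \<Rightarrow> bool" where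
  "C_k 0 \<phi> \<longleftrightarrow> continuous_on UNIV \<phi>"
| "C_k (Suc k) \<phi> \<longleftrightarrow> (\<forall>p. \<phi> differentiable (at p)) \<and>
     (\<forall>b\<in>Basis. C_k k (\<lambda>p. frechet_derivative \<phi> (at p) b))"

definition test_function :: "('a::euclidean_space \<Rightarrow> real) \<Rightarrow> bool" where
  "test_function \<phi> \<longleftrightarrow> (\<forall>k. C_k k \<phi>) \<and> compact (closure {p. \<phi> p \<noteq> 0})"

text \<open>
  A finite signed Borel measure is a countably additive real-valued set function on the Borel
  sets; its values on other sets are irrelevant. On a Euclidean space every such measure is a
  signed Radon measure.
\<close>

definition signed_measure :: "('a::topological_space set \<Rightarrow> real) \<Rightarrow> bool" where
  "signed_measure \<nu> \<longleftrightarrow> \<nu> {} = 0 \<and>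
     (\<forall>A. range A \<subseteq> sets borel \<and> disjoint_family A \<longrightarrow> (\<lambda>i::nat. \<nu> (A i)) sums \<nu> (\<Union>i. A i))"

definition total_variation :: "('a::topological_space set \<Rightarrow> real) \<Rightarrow> ennreal" where
  "total_variation \<nu> =
     (SUP A \<in> {A. range A \<subseteq> sets borel \<and> disjoint_family A \<and> (\<Union>i. A i) = UNIV}.
        \<Sum>i::nat. ennreal \<bar>\<nu> (A i)\<bar>)"

text \<open>
  The positive part of the Jordan decomposition, $\nu^+(A) = \sup \{\nu(B) : B \subseteq A\}$.
  Negative values of $\nu(B)$ are truncated to 0 by \<open>ennreal\<close>, which does not affect the
  supremum because $\nu(\emptyset) = 0$. The negative part is the positive part of $-\nu$.
\<close>

definition positive_part :: "('a::topological_space set \<Rightarrow> real) \<Rightarrow> 'a measure" where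
  "positive_part \<nu> =
     measure_of UNIV (sets borel) (\<lambda>A. SUP B \<in> {B \<in> sets borel. B \<subseteq> A}. ennreal (\<nu> B))"

definition signed_integral ::
    "('a::topological_space set \<Rightarrow> real) \<Rightarrow> ('a \<Rightarrow> real) \<Rightarrow> real" where
  "signed_integral \<nu> \<phi> =
     (\<integral>p. \<phi> p \<partial>positive_part \<nu>) - (\<integral>p. \<phi> p \<partial>positive_part (\<lambda>A. - \<nu> A))"

text \<open>
  \<open>measure_derivative Z f \<nu>\<close> says that the distributional derivative of \<open>f\<close> along the vector
  field \<open>Z\<close> is the signed measure \<open>\<nu>\<close> of finite total variation. No divergence term appears,
  since the fields \<open>X_field\<close> and \<open>Y_field\<close> are divergence-free.
\<close>

definition measure_derivative ::
    "((heis \<Rightarrow> real) \<Rightarrow> heis \<Rightarrow> real) \<Rightarrow> (heis \<Rightarrow> real) \<Rightarrow> (heis set \<Rightarrow> real) \<Rightarrow> bool" where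
  "measure_derivative Z f \<nu> \<longleftrightarrow> signed_measure \<nu> \<and> total_variation \<nu> < \<infinity> \<and>
     (\<forall>\<phi>. test_function \<phi> \<longrightarrow> (\<integral>p. f p * Z \<phi> p \<partial>lebesgue) = - signed_integral \<nu> \<phi>)"

definition BV_heis :: "(heis \<Rightarrow> real) set" where
  "BV_heis = {f. integrable lebesgue f \<and>
     (\<exists>\<mu>. measure_derivative X_field f \<mu>) \<and> (\<exists>\<nu>. measure_derivative Y_field f \<nu>)}"

text \<open>The $L^p$ norm takes the value \<open>\<infinity>\<close> if $|f|^p$ is not integrable.\<close>

definition Lp_norm :: "real \<Rightarrow> (heis \<Rightarrow> real) \<Rightarrow> ennreal" where
  "Lp_norm p f =
     (let I = (\<integral>\<^sup>+ u. ennreal (\<bar>f u\<bar> powr p) \<partial>lebesgue)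
      in if I = \<infinity> then \<infinity> else ennreal (enn2real I powr (1 / p)))"

end

theory Submission
  imports Defs
begin

text \<open>Let \<open>N\<close> be the X-ray transform of a planar set \<open>A\<close> along the lines \<open>t = \<tau> + x y\<close>. On each line,
  \<open>N\<^sup>3\<close> is at most \<open>8\<close> times the integral of \<open>\<bar>y' - y\<bar>\<close> over pairs of points of \<open>A\<close> on that line, and
  \<open>\<bar>y' - y\<bar>\<close> is precisely the Jacobian of (point, line through it, second point) against (point, point);
  hence \<open>\<integral> N\<^sup>3 \<le> 8 \<bar>A\<bar>\<^sup>2\<close>. This gives the restricted Loomis--Whitney inequality
  \<open>\<bar>E\<bar> \<le> 9 (\<bar>A\<bar> \<bar>B\<bar>)\<^bsup>2/3\<^esup>\<close> for sets \<open>E\<close> whose projections along the two families of horizontal lines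
  lie in \<open>A\<close> and \<open>B\<close>.

  If \<open>u\<close> is continuous and integrable and \<open>\<bar>u\<bar> \<ge> 2\<^bsup>k+1\<^esup>\<close> at some point of a horizontal line, then the
  derivative along the line has integral at least \<open>2\<^sup>k\<close> over the layer \<open>2\<^sup>k < \<bar>u\<bar> < 2\<^bsup>k+1\<^esup>\<close>. By Chebyshev's
  inequality the superlevel set projects into sets of measure \<open>2\<^bsup>-k\<^esup>x\<^sub>k\<close> and \<open>2\<^bsup>-k\<^esup>y\<^sub>k\<close>, where \<open>x\<^sub>k\<close> and \<open>y\<^sub>k\<close>
  are the masses of the two derivatives on the layer. Since the layers are disjoint, the terms
  \<open>(x\<^sub>k y\<^sub>k)\<^bsup>2/3\<^esup>\<close> can be summed over \<open>k\<close>. A \<open>BV\<close> function is reduced to this case by left-invariant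
  mollification, which commutes with \<open>X\<close> and \<open>Y\<close>.\<close>

subsection \<open>Test functions and mollifiers\<close>

lemma C_k_SucI:
  assumes "\<And>p. (\<phi> has_derivative D p) (at p)"
    and "\<And>b. b \<in> Basis \<Longrightarrow> C_k k (\<lambda>p. D p b)"
  shows "C_k (Suc k) \<phi>"
proof -
  have "frechet_derivative \<phi> (at p) = D p" for p
    using assms(1) frechet_derivative_at by metis
  then show ?thesis
    using assms by (auto simp: differentiable_def)
qed

lemma C_k_has_derivative:
  "C_k (Suc k) \<phi> \<Longrightarrow> (\<phi> has_derivative frechet_derivative \<phi> (at p)) (at p)"
  by (simp add: frechet_derivative_works)

lemma C_k_derivative_linear: "C_k (Suc k) \<phi> \<Longrightarrow> linear (frechet_derivative \<phi> (at p))"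
  by (rule has_derivative_linear[OF C_k_has_derivative])

text \<open>\<open>C_k\<close> controls derivatives along basis vectors only. Linearity of the
  Frechet derivative recovers every direction, in particular one that varies with the point, as for
  the horizontal fields.\<close>

lemma C_k_derivative_expand:
  assumes "C_k (Suc k) \<phi>"
  shows "frechet_derivative \<phi> (at p) v = (\<Sum>b\<in>Basis. (v \<bullet> b) * frechet_derivative \<phi> (at p) b)"
proof -
  let ?D = "frechet_derivative \<phi> (at p)"
  interpret linear ?D by (rule C_k_derivative_linear[OF assms])
  have "?D v = ?D (\<Sum>b\<in>Basis. (v \<bullet> b) *\<^sub>R b)" by (simp add: euclidean_representation)
  also have "\<dots> = (\<Sum>b\<in>Basis. (v \<bullet> b) * ?D b)" by (simp only: sum scaleR) simp
  finally show ?thesis .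
qed

lemma C_k_partial: "C_k (Suc k) \<phi> \<Longrightarrow> b \<in> Basis \<Longrightarrow> C_k k (\<lambda>p. frechet_derivative \<phi> (at p) b)"
  by simp

lemma C_k_Suc_imp: "C_k (Suc k) \<phi> \<Longrightarrow> C_k k \<phi>"
proof (induction k arbitrary: \<phi>)
  case 0
  then show ?case
    by (auto intro!: differentiable_imp_continuous_on simp: differentiable_on_def)
next
  case (Suc k)
  show ?case
    by (rule C_k_SucI[OF C_k_has_derivative[OF Suc.prems]]) (intro Suc.IH C_k_partial[OF Suc.prems])
qed

lemma C_k_imp_continuous: "C_k k \<phi> \<Longrightarrow> continuous_on UNIV \<phi>"
  by (induction k) (use C_k_Suc_imp in auto)

lemma continuous_on_C_k_derivative:
  assumes C: "C_k (Suc 0) \<phi>" and g: "continuous_on S g" and v: "continuous_on S v"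
  shows "continuous_on S (\<lambda>z. frechet_derivative \<phi> (at (g z)) (v z))"
proof (subst C_k_derivative_expand[OF C], intro continuous_on_sum continuous_on_mult)
  fix b :: 'a assume b: "b \<in> Basis"
  show "continuous_on S (\<lambda>z. v z \<bullet> b)" by (intro continuous_intros v)
  show "continuous_on S (\<lambda>z. frechet_derivative \<phi> (at (g z)) b)"
    by (rule continuous_on_compose2[OF _ g, of UNIV]) (use C_k_partial[OF C b] in simp_all)
qed

lemma C_k_const: "C_k k (\<lambda>_. c)"
proof (induction k arbitrary: c)
  case (Suc k)
  show ?case by (rule C_k_SucI[OF has_derivative_const]) (rule Suc)
qed simp

lemma C_k_bounded_linear: "bounded_linear L \<Longrightarrow> C_k k L"
proof (cases k)
  case (Suc m)
  assume "bounded_linear L"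
  then show ?thesis unfolding Suc
    by (intro C_k_SucI[OF bounded_linear_imp_has_derivative] C_k_const)
qed (simp add: linear_continuous_on)

lemma C_k_add: "C_k k \<phi> \<Longrightarrow> C_k k \<psi> \<Longrightarrow> C_k k (\<lambda>p. \<phi> p + \<psi> p)"
proof (induction k arbitrary: \<phi> \<psi>)
  case 0 then show ?case by (simp add: continuous_on_add)
next
  case (Suc k)
  show ?case
    by (rule C_k_SucI[OF has_derivative_add[OF Suc.prems[THEN C_k_has_derivative]]])
      (intro Suc.IH C_k_partial Suc.prems)
qed

lemma C_k_mult: "C_k k \<phi> \<Longrightarrow> C_k k \<psi> \<Longrightarrow> C_k k (\<lambda>p. \<phi> p * \<psi> p)"
proof (induction k arbitrary: \<phi> \<psi>)
  case 0 then show ?case by (simp add: continuous_on_mult)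
next
  case (Suc k)
  show ?case
    by (rule C_k_SucI[OF has_derivative_mult[OF Suc.prems[THEN C_k_has_derivative]]])
      (intro C_k_add Suc.IH C_k_partial Suc.prems Suc.prems[THEN C_k_Suc_imp])
qed

lemma C_k_sum: "(\<And>i. i \<in> I \<Longrightarrow> C_k k (\<phi> i)) \<Longrightarrow> C_k k (\<lambda>p. \<Sum>i\<in>I. \<phi> i p)"
  by (induction I rule: infinite_finite_induct) (auto intro: C_k_const C_k_add)

text \<open>For an affine inner map the chain rule has the constant coefficients
  \<open>L b \<bullet> i\<close>, so each partial derivative is a finite sum of functions of the
  same form and the induction closes. It is applied to w \<mapsto> p \<odot> - w, which is
  affine.\<close>

lemma C_k_affine:
  fixes L :: "'a::euclidean_space \<Rightarrow> 'b::euclidean_space"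
  assumes L: "bounded_linear L" and "C_k k \<phi>"
  shows "C_k k (\<lambda>p. \<phi> (c + L p))"
  using assms(2)
proof (induction k arbitrary: \<phi>)
  case 0
  then show ?case
    using continuous_on_compose2[of UNIV \<phi> UNIV "\<lambda>p. c + L p"]
      continuous_on_add[OF continuous_on_const linear_continuous_on[OF L]] by auto
next
  case (Suc k)
  let ?D = "\<lambda>q. frechet_derivative \<phi> (at q)"
  note D = C_k_has_derivative[OF Suc.prems]
  have deriv: "((\<lambda>p. \<phi> (c + L p)) has_derivative (\<lambda>h. ?D (c + L p) (L h))) (at p)" for p
  proof -
    have "((\<lambda>p. c + L p) has_derivative L) (at p)"
      using has_derivative_add[OF has_derivative_const[of c] bounded_linear_imp_has_derivative[OF L]]
      by simp
    from has_derivative_compose[OF this D] show ?thesis .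
  qed
  show ?case
  proof (rule C_k_SucI)
    show "((\<lambda>p. \<phi> (c + L p)) has_derivative
      (\<lambda>h. \<Sum>b\<in>Basis. (L h \<bullet> b) * ?D (c + L p) b)) (at p)" for p
      by (rule has_derivative_eq_rhs[OF deriv]) (rule ext, rule C_k_derivative_expand[OF Suc.prems])
    show "C_k k (\<lambda>p. \<Sum>i\<in>Basis. (L b \<bullet> i) * ?D (c + L p) i)" for b
    proof (rule C_k_sum)
      fix i :: 'b assume "i \<in> Basis"
      from Suc.IH[OF C_k_partial[OF Suc.prems this]]
      show "C_k k (\<lambda>p. (L b \<bullet> i) * ?D (c + L p) i)"
        by (rule C_k_mult[OF C_k_const])
    qed
  qed
qed

section \<open>Smooth functions that are flat at the origin\<close>

definition flat_exp :: "real poly \<Rightarrow> real \<Rightarrow> real" where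
  "flat_exp P u = (if u > 0 then poly P (inverse u) * exp (- inverse u) else 0)"

lemma poly_over_exp_tendsto_0: "((\<lambda>x::real. poly P x * exp (- x)) \<longlongrightarrow> 0) at_top"
proof -
  have "((\<lambda>x::real. \<Sum>i\<le>degree P. coeff P i * (x ^ i / exp x)) \<longlongrightarrow> (\<Sum>i\<le>degree P. coeff P i * 0)) at_top"
    by (intro tendsto_sum tendsto_mult tendsto_const tendsto_power_div_exp_0)
  moreover have "(\<Sum>i\<le>degree P. coeff P i * (x ^ i / exp x)) = poly P x * exp (- x)" for x :: real
    by (simp add: poly_altdef sum_distrib_right exp_minus divide_inverse mult.assoc)
  ultimately show ?thesis by simp
qed

text \<open>Differentiating 1/u produces the factor u^(-2), which is \<open>[:0, 0, 1:]\<close>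
  evaluated at 1/u. At 0 the right difference quotient is again a polynomial in 1/h times exp(-1/h),
  so it tends to 0.\<close>

lemma flat_exp_has_derivative:
  "(flat_exp P has_real_derivative flat_exp ([:0, 0, 1:] * (P - pderiv P)) u) (at u)"
proof -
  consider "u > 0" | "u < 0" | "u = 0" by linarith
  then show ?thesis
  proof cases
    case 1
    have "((\<lambda>u. poly P (inverse u) * exp (- inverse u)) has_real_derivative
        flat_exp ([:0, 0, 1:] * (P - pderiv P)) u) (at u)"
      using 1 by (auto intro!: derivative_eq_intros poly_DERIV[THEN DERIV_chain2]
          simp: flat_exp_def power2_eq_square algebra_simps)
    then show ?thesis
      by (rule has_field_derivative_transform_within_open[of _ _ _ "{0<..}"])
        (use 1 in \<open>auto simp: flat_exp_def\<close>)
  next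
    case 2
    have "((\<lambda>u. 0) has_real_derivative flat_exp ([:0, 0, 1:] * (P - pderiv P)) u) (at u)"
      using 2 by (simp add: flat_exp_def)
    then show ?thesis
      by (rule has_field_derivative_transform_within_open[of _ _ _ "{..<0}"])
        (use 2 in \<open>auto simp: flat_exp_def\<close>)
  next
    case 3
    have "((\<lambda>h. poly ([:0, 1:] * P) (inverse h) * exp (- inverse h)) \<longlongrightarrow> 0) (at_right 0)"
      by (rule filterlim_compose[OF poly_over_exp_tendsto_0 filterlim_inverse_at_top_right])
    then have "((\<lambda>h. flat_exp P h / h) \<longlongrightarrow> 0) (at_right 0)"
      by (rule Lim_transform_eventually)
        (auto simp: eventually_at_filter flat_exp_def field_simps)
    moreover have "((\<lambda>h. flat_exp P h / h) \<longlongrightarrow> 0) (at_left 0)"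
      by (rule Lim_transform_eventually[OF tendsto_const])
        (auto simp: eventually_at_filter flat_exp_def)
    ultimately have "((\<lambda>h. flat_exp P h / h) \<longlongrightarrow> 0) (at 0)"
      by (simp add: filterlim_split_at)
    then show ?thesis using 3 by (simp add: DERIV_def flat_exp_def)
  qed
qed

lemma C_k_flat_exp: "(\<And>k. C_k k \<phi>) \<Longrightarrow> C_k k (\<lambda>p. flat_exp P (\<phi> p))"
proof (induction k arbitrary: P)
  case 0
  have "continuous_on UNIV (flat_exp P)"
    using flat_exp_has_derivative DERIV_isCont by (blast intro: continuous_at_imp_continuous_on)
  then show ?case
    using continuous_on_compose2[of UNIV "flat_exp P" UNIV \<phi>] C_k_imp_continuous[OF 0] by simp
next
  case (Suc k)
  show ?case
  proof (rule C_k_SucI)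
    show "((\<lambda>p. flat_exp P (\<phi> p)) has_derivative
       (\<lambda>h. flat_exp ([:0, 0, 1:] * (P - pderiv P)) (\<phi> p) * frechet_derivative \<phi> (at p) h)) (at p)" for p
      using has_derivative_compose[where f=\<phi> and g="flat_exp P", OF C_k_has_derivative[OF Suc.prems]
          flat_exp_has_derivative[unfolded has_field_derivative_def]] by this
  qed (rule C_k_mult[OF Suc.IH[OF Suc.prems] C_k_partial[OF Suc.prems]])
qed

section \<open>Bounded supports and normalised bump functions\<close>

lemma test_function_bounded_support:
  assumes "test_function \<phi>"
  obtains R where "R > 0" "\<And>p. \<phi> p \<noteq> 0 \<Longrightarrow> norm p \<le> R"
proof -
  have "bounded (closure {p. \<phi> p \<noteq> 0})"
    using assms by (simp add: test_function_def compact_imp_bounded)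
  then have "bounded {p. \<phi> p \<noteq> 0}"
    by (rule bounded_subset[OF _ closure_subset])
  then show ?thesis using that by (auto simp: bounded_pos)
qed

lemma test_functionI:
  assumes "\<And>k. C_k k \<phi>" "\<And>p. \<phi> p \<noteq> 0 \<Longrightarrow> norm p \<le> R"
  shows "test_function \<phi>"
proof -
  have "bounded {p. \<phi> p \<noteq> 0}" using assms(2) by (auto simp: bounded_iff)
  then show ?thesis using assms(1) by (simp add: test_function_def compact_eq_bounded_closed bounded_closure)
qed

lemma test_function_continuous: "test_function \<phi> \<Longrightarrow> continuous_on UNIV \<phi>"
  by (metis test_function_def C_k.simps(1))

lemma continuous_bounded_support_bounded:
  fixes \<phi> :: "'a::euclidean_space \<Rightarrow> real"
  assumes "continuous_on UNIV \<phi>" "\<And>p. \<phi> p \<noteq> 0 \<Longrightarrow> norm p \<le> R"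
  obtains M where "M > 0" "\<And>p. \<bar>\<phi> p\<bar> \<le> M"
proof -
  have "compact (\<phi> ` cball 0 R)"
    using assms(1) by (intro compact_continuous_image) (auto intro: continuous_on_subset)
  then obtain M where M: "M > 0" "\<And>p. norm p \<le> R \<Longrightarrow> \<bar>\<phi> p\<bar> \<le> M"
    using compact_imp_bounded by (force simp: bounded_pos)
  have "\<bar>\<phi> p\<bar> \<le> M" for p
    using M assms(2)[of p] by (cases "\<phi> p = 0") auto
  then show ?thesis using that M(1) by blast
qed

lemma continuous_bounded_support_integrable:
  fixes \<phi> :: "'a::euclidean_space \<Rightarrow> real"
  assumes "continuous_on UNIV \<phi>" "\<And>p. \<phi> p \<noteq> 0 \<Longrightarrow> norm p \<le> R"
  shows "integrable lborel \<phi>"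
proof -
  have "integrable lborel (\<lambda>x. indicator (cball 0 R) x *\<^sub>R \<phi> x)"
    using assms(1) by (intro borel_integrable_compact) (auto intro: continuous_on_subset)
  also have "(\<lambda>x. indicator (cball 0 R) x *\<^sub>R \<phi> x) = \<phi>"
  proof
    fix x show "indicator (cball 0 R) x *\<^sub>R \<phi> x = \<phi> x"
      using assms(2)[of x] by (cases "\<phi> x = 0") (auto simp: indicator_def)
  qed
  finally show ?thesis .
qed

text \<open>The bump exp(-1/(\<epsilon>^2 - |q|^2)) on the ball of radius \<epsilon> is divided by
  its integral.\<close>

lemma mollifier_exists:
  assumes "\<epsilon> > 0"
  obtains \<rho> :: "'a::euclidean_space \<Rightarrow> real"
  where "test_function \<rho>" "\<And>q. \<rho> q \<ge> 0" "\<And>q. \<rho> q \<noteq> 0 \<Longrightarrow> norm q < \<epsilon>"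
    "(\<integral>\<^sup>+ q. ennreal (\<rho> q) \<partial>lborel) = 1"
proof -
  \<comment> \<open>The squared norm is written in coordinates so that the closure rules for
    \<open>C_k\<close> apply to the argument of \<open>flat_exp\<close>.\<close>
  define h :: "'a \<Rightarrow> real" where "h = (\<lambda>q. flat_exp 1 (\<epsilon>\<^sup>2 + (-1) * (\<Sum>b\<in>Basis. (q \<bullet> b) * (q \<bullet> b))))"
  have h: "h q = (if norm q < \<epsilon> then exp (- inverse (\<epsilon>\<^sup>2 - (norm q)\<^sup>2)) else 0)" for q
  proof -
    have "(\<Sum>b\<in>Basis. (q \<bullet> b) * (q \<bullet> b)) = (norm q)\<^sup>2"
      by (simp add: power2_norm_eq_inner flip: euclidean_inner)
    moreover have "(norm q)\<^sup>2 < \<epsilon>\<^sup>2 \<longleftrightarrow> norm q < \<epsilon>"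
      using assms by (meson norm_ge_zero less_imp_le power_less_imp_less_base power_strict_mono zero_less_numeral)
    ultimately show ?thesis by (simp add: h_def flat_exp_def)
  qed
  have Ck: "C_k k h" for k
    unfolding h_def
    by (intro C_k_flat_exp C_k_add C_k_mult C_k_const C_k_sum C_k_bounded_linear bounded_linear_inner_left)
  have supp: "norm q < \<epsilon>" if "h q \<noteq> 0" for q using that h by (auto split: if_splits)
  have nonneg: "h q \<ge> 0" for q by (simp add: h)
  have cont: "continuous_on UNIV h" using Ck[of 0] by simp
  have int: "integrable lborel h"
    by (rule continuous_bounded_support_integrable[OF cont, of \<epsilon>]) (use supp in \<open>auto simp: less_imp_le\<close>)
  define c where "c = integral\<^sup>L lborel h"
  \<comment> \<open>If the integral vanished, \<open>h\<close>, which is positive on the ball, would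
    be 0 almost everywhere and the ball would be null.\<close>
  have "c \<noteq> 0"
  proof
    assume "c = 0"
    then have "AE q in lborel. h q = 0"
      using integral_nonneg_eq_0_iff_AE[OF int] nonneg by (simp add: c_def)
    then have "AE q in lborel. q \<notin> ball (0::'a) \<epsilon>"
      by (rule AE_mp) (auto intro!: AE_I2 simp: h)
    then have "emeasure lborel (ball (0::'a) \<epsilon>) = 0"
      by (subst AE_iff_measurable[symmetric, of _ _ "\<lambda>q. q \<notin> ball (0::'a) \<epsilon>"]) auto
    then show False
      using emeasure_ball[of \<epsilon> "0::'a"] assms unit_ball_vol_pos[of "DIM('a)"] by simp
  qed
  moreover have "c \<ge> 0" unfolding c_def using nonneg by simp
  ultimately have c: "c > 0" by simp
  show ?thesis
  proof
    show "test_function (\<lambda>q. inverse c * h q)"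
      by (rule test_functionI[of _ \<epsilon>], intro C_k_mult C_k_const Ck)
         (use supp in \<open>auto simp: less_imp_le\<close>)
    show "inverse c * h q \<ge> 0" for q using c nonneg by simp
    show "norm q < \<epsilon>" if "inverse c * h q \<noteq> 0" for q using that supp by simp
    have "(\<integral>\<^sup>+ q. ennreal (inverse c * h q) \<partial>lborel) = ennreal (\<integral>q. inverse c * h q \<partial>lborel)"
      using int c nonneg by (intro nn_integral_eq_integral) auto
    also have "(\<integral>q. inverse c * h q \<partial>lborel) = 1" using \<open>c \<noteq> 0\<close> by (simp add: c_def)
    finally show "(\<integral>\<^sup>+ q. ennreal (inverse c * h q) \<partial>lborel) = 1" by simp
  qed
qed

subsection \<open>The restricted Loomis--Whitney inequality\<close>

lemma nn_integral_lborel_pair: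
  fixes F :: "'a::euclidean_space \<times> 'b::euclidean_space \<Rightarrow> ennreal"
  assumes [measurable]: "F \<in> borel_measurable borel"
  shows "(\<integral>\<^sup>+z. F z \<partial>lborel) = (\<integral>\<^sup>+x. \<integral>\<^sup>+y. F (x, y) \<partial>lborel \<partial>lborel)"
  by (subst lborel_prod[symmetric], rule lborel.nn_integral_fst[symmetric]) (simp add: lborel_prod)

lemma nn_integral_lborel_triple:
  fixes F :: "'a::euclidean_space \<times> 'b::euclidean_space \<times> 'c::euclidean_space \<Rightarrow> ennreal"
  assumes [measurable]: "F \<in> borel_measurable borel"
  shows "(\<integral>\<^sup>+p. F p \<partial>lborel) = (\<integral>\<^sup>+x. \<integral>\<^sup>+y. \<integral>\<^sup>+t. F (x, y, t) \<partial>lborel \<partial>lborel \<partial>lborel)"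
proof -
  have [measurable]: "F \<in> borel_measurable (borel \<Otimes>\<^sub>M borel)"
    by (simp add: borel_prod)
  have "(\<integral>\<^sup>+p. F p \<partial>lborel) = (\<integral>\<^sup>+x. \<integral>\<^sup>+z. F (x, z) \<partial>lborel \<partial>lborel)"
    by (rule nn_integral_lborel_pair) simp
  also have "\<dots> = (\<integral>\<^sup>+x. \<integral>\<^sup>+y. \<integral>\<^sup>+t. F (x, y, t) \<partial>lborel \<partial>lborel \<partial>lborel)"
    by (intro nn_integral_cong nn_integral_lborel_pair) measurable
  finally show ?thesis .
qed

lemma nn_integral_lborel_shift:
  fixes c :: real
  assumes "F \<in> borel_measurable borel"
  shows "(\<integral>\<^sup>+t. F (t + c) \<partial>lborel) = (\<integral>\<^sup>+t. F t \<partial>lborel)"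
  using nn_integral_real_affine[OF assms, of 1 c] by (simp add: add.commute)

section \<open>Pairs of points of a planar set on a common line\<close>

text \<open>Removing from S the interval of length m/2 centred at c leaves measure at least m/2, all
  of it at distance more than m/4 from c; the product of these two numbers is the bound.\<close>

lemma bathtub:
  fixes S :: "real set"
  assumes S[measurable]: "S \<in> sets borel" and m: "0 \<le> m" "ennreal m \<le> emeasure lborel S"
  shows "ennreal (m\<^sup>2 / 8) \<le> (\<integral>\<^sup>+y. indicator S y * ennreal \<bar>y - c\<bar> \<partial>lborel)"
proof -
  define T where "T = S - {c - m / 4..c + m / 4}"
  have [measurable]: "T \<in> sets borel" by (simp add: T_def)
  have "ennreal m \<le> emeasure lborel (T \<union> {c - m / 4..c + m / 4})"
    by (rule order_trans[OF m(2)], rule emeasure_mono) (auto simp: T_def)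
  also have "\<dots> \<le> emeasure lborel T + emeasure lborel {c - m / 4..c + m / 4}"
    by (rule emeasure_subadditive) auto
  also have "emeasure lborel {c - m / 4..c + m / 4} = ennreal (m / 2)"
    using m(1) by simp
  finally have *: "ennreal (m / 2) \<le> emeasure lborel T"
    using m(1) by (cases "emeasure lborel T") (auto simp flip: ennreal_plus)
  have "ennreal (m\<^sup>2 / 8) = ennreal (m / 4) * ennreal (m / 2)"
    using m(1) by (simp add: power2_eq_square flip: ennreal_mult)
  also have "\<dots> \<le> ennreal (m / 4) * emeasure lborel T"
    by (intro mult_left_mono *) auto
  also have "\<dots> = (\<integral>\<^sup>+y. ennreal (m / 4) * indicator T y \<partial>lborel)"
    by (simp add: nn_integral_cmult_indicator)
  also have "\<dots> \<le> (\<integral>\<^sup>+y. indicator S y * ennreal \<bar>y - c\<bar> \<partial>lborel)"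
    by (rule nn_integral_mono) (auto simp: T_def indicator_def abs_real_def intro!: ennreal_leI)
  finally show ?thesis .
qed

text \<open>If |S| > r, then \<open>bathtub\<close> with m = r, applied around every point y of S,
  gives |S| r^2/8 \<le> Q, where Q is the double integral. This is |S|^3 \<le> 8 Q in a form linear
  in Q: it can be integrated over all lines with one r, which is optimised only at the end.\<close>

lemma emeasure_le_self_interaction:
  fixes S :: "real set"
  assumes S[measurable]: "S \<in> sets borel" and r: "r > 0"
  shows "emeasure lborel S \<le> ennreal r + ennreal (8 / r\<^sup>2) *
    (\<integral>\<^sup>+y. \<integral>\<^sup>+y'. indicator S y * indicator S y' * ennreal \<bar>y' - y\<bar> \<partial>lborel \<partial>lborel)"
    (is "_ \<le> _ + _ * ?Q")
proof (cases "emeasure lborel S \<le> ennreal r")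
  case False
  then have m: "ennreal r \<le> emeasure lborel S" by simp
  have "emeasure lborel S * ennreal (r\<^sup>2 / 8)
      = (\<integral>\<^sup>+y. indicator S y * ennreal (r\<^sup>2 / 8) \<partial>lborel)"
    by (simp add: nn_integral_multc)
  also have "\<dots> \<le> (\<integral>\<^sup>+y. indicator S y * (\<integral>\<^sup>+y'. indicator S y' * ennreal \<bar>y' - y\<bar> \<partial>lborel) \<partial>lborel)"
    using r m by (intro nn_integral_mono mult_left_mono bathtub) auto
  also have "\<dots> = ?Q"
    by (simp add: nn_integral_cmult mult.assoc)
  finally have "ennreal (8 / r\<^sup>2) * (emeasure lborel S * ennreal (r\<^sup>2 / 8)) \<le> ennreal (8 / r\<^sup>2) * ?Q"
    by (rule mult_left_mono) simp
  then show ?thesis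
    using r by (simp add: mult.left_commute add_increasing flip: ennreal_mult)
qed (simp add: add_increasing2)

text \<open>A line with slope x and intercept \<tau>, together with two points on it, is traded for
  the two points alone. The exchanges of integrals serve to bring the slope to the innermost place,
  where it parametrises the height of the second point.\<close>

lemma line_self_interaction_le:
  fixes A :: "(real \<times> real) set"
  assumes A: "A \<in> sets borel"
  shows "(\<integral>\<^sup>+x. \<integral>\<^sup>+\<tau>. \<integral>\<^sup>+y. \<integral>\<^sup>+y'. indicator A (y, \<tau> + x * y) * indicator A (y', \<tau> + x * y') *
      ennreal \<bar>y' - y\<bar> \<partial>lborel \<partial>lborel \<partial>lborel \<partial>lborel) \<le> emeasure lborel A * emeasure lborel A"
proof -
  define a :: "real \<times> real \<Rightarrow> ennreal" where "a = indicator A"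
  have ab: "a \<in> borel_measurable borel" using A by (simp add: a_def)
  then have [measurable]: "a \<in> borel_measurable (borel \<Otimes>\<^sub>M borel)" by (simp add: borel_prod)
  have m: "emeasure lborel A = (\<integral>\<^sup>+y. \<integral>\<^sup>+t. a (y, t) \<partial>lborel \<partial>lborel)"
    using A nn_integral_lborel_pair[OF ab] by (simp add: a_def)
  have "(\<integral>\<^sup>+x. \<integral>\<^sup>+\<tau>. \<integral>\<^sup>+y. \<integral>\<^sup>+y'. a (y, \<tau> + x * y) * a (y', \<tau> + x * y') * ennreal \<bar>y' - y\<bar> \<partial>lborel \<partial>lborel \<partial>lborel \<partial>lborel)
    = (\<integral>\<^sup>+x. \<integral>\<^sup>+y. \<integral>\<^sup>+\<tau>. \<integral>\<^sup>+y'. a (y, \<tau> + x * y) * a (y', \<tau> + x * y') * ennreal \<bar>y' - y\<bar> \<partial>lborel \<partial>lborel \<partial>lborel \<partial>lborel)"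
    by (rule nn_integral_cong, rule lborel_pair.Fubini') measurable
  also have "\<dots> = (\<integral>\<^sup>+y. \<integral>\<^sup>+x. \<integral>\<^sup>+\<tau>. \<integral>\<^sup>+y'. a (y, \<tau> + x * y) * a (y', \<tau> + x * y') * ennreal \<bar>y' - y\<bar> \<partial>lborel \<partial>lborel \<partial>lborel \<partial>lborel)"
    by (intro lborel_pair.Fubini') measurable
  also have "\<dots> = (\<integral>\<^sup>+y. \<integral>\<^sup>+x. \<integral>\<^sup>+y'. \<integral>\<^sup>+\<tau>. a (y, \<tau> + x * y) * a (y', \<tau> + x * y') * ennreal \<bar>y' - y\<bar> \<partial>lborel \<partial>lborel \<partial>lborel \<partial>lborel)"
    by (rule nn_integral_cong, rule nn_integral_cong, rule lborel_pair.Fubini') measurable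
  \<comment> \<open>The intercept is replaced by the height t = \<tau> + x y of the first
    point.\<close>
  also have "\<dots> = (\<integral>\<^sup>+y. \<integral>\<^sup>+x. \<integral>\<^sup>+y'. \<integral>\<^sup>+t. a (y, t) * a (y', t + x * (y' - y)) * ennreal \<bar>y' - y\<bar> \<partial>lborel \<partial>lborel \<partial>lborel \<partial>lborel)"
  proof (rule nn_integral_cong, rule nn_integral_cong, rule nn_integral_cong)
    fix y x y' :: real
    have "(\<lambda>t. a (y, t) * a (y', t + x * (y' - y)) * ennreal \<bar>y' - y\<bar>) \<in> borel_measurable borel"
      by measurable
    from nn_integral_lborel_shift[OF this, of "x * y"]
    show "(\<integral>\<^sup>+\<tau>. a (y, \<tau> + x * y) * a (y', \<tau> + x * y') * ennreal \<bar>y' - y\<bar> \<partial>lborel)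
      = (\<integral>\<^sup>+t. a (y, t) * a (y', t + x * (y' - y)) * ennreal \<bar>y' - y\<bar> \<partial>lborel)"
      by (simp add: algebra_simps)
  qed
  also have "\<dots> = (\<integral>\<^sup>+y. \<integral>\<^sup>+y'. \<integral>\<^sup>+x. \<integral>\<^sup>+t. a (y, t) * a (y', t + x * (y' - y)) * ennreal \<bar>y' - y\<bar> \<partial>lborel \<partial>lborel \<partial>lborel \<partial>lborel)"
    by (rule nn_integral_cong, rule lborel_pair.Fubini') measurable
  also have "\<dots> = (\<integral>\<^sup>+y. \<integral>\<^sup>+y'. \<integral>\<^sup>+t. \<integral>\<^sup>+x. a (y, t) * a (y', t + x * (y' - y)) * ennreal \<bar>y' - y\<bar> \<partial>lborel \<partial>lborel \<partial>lborel \<partial>lborel)"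
    by (rule nn_integral_cong, rule nn_integral_cong, rule lborel_pair.Fubini') measurable
  \<comment> \<open>For y' \<noteq> y the weight |y' - y| is the Jacobian of v = t + x (y' - y). On
    the diagonal the left side is 0, and an inequality remains.\<close>
  also have "\<dots> \<le> (\<integral>\<^sup>+y. \<integral>\<^sup>+y'. \<integral>\<^sup>+t. a (y, t) * (\<integral>\<^sup>+v. a (y', v) \<partial>lborel) \<partial>lborel \<partial>lborel \<partial>lborel)"
  proof (intro nn_integral_mono)
    fix y y' t :: real
    have "(\<integral>\<^sup>+x. a (y', t + x * (y' - y)) * ennreal \<bar>y' - y\<bar> \<partial>lborel) \<le> (\<integral>\<^sup>+v. a (y', v) \<partial>lborel)"
    proof (cases "y' = y")
      case False
      then have "(\<integral>\<^sup>+v. a (y', v) \<partial>lborel) = ennreal \<bar>y' - y\<bar> * (\<integral>\<^sup>+x. a (y', t + (y' - y) * x) \<partial>lborel)"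
        by (intro nn_integral_real_affine) auto
      then show ?thesis by (simp add: nn_integral_multc mult.commute[of "ennreal _"] mult.commute[of _ "y' - y"])
    qed simp
    from mult_left_mono[OF this, of "a (y, t)"]
    show "(\<integral>\<^sup>+x. a (y, t) * a (y', t + x * (y' - y)) * ennreal \<bar>y' - y\<bar> \<partial>lborel)
      \<le> a (y, t) * (\<integral>\<^sup>+v. a (y', v) \<partial>lborel)"
      by (simp add: mult.assoc nn_integral_cmult)
  qed
  also have "\<dots> = emeasure lborel A * emeasure lborel A"
    unfolding m by (simp add: nn_integral_multc nn_integral_cmult)
  finally show ?thesis by (simp add: a_def)
qed

section \<open>Sets with prescribed projections along horizontal lines\<close>

text \<open>The pair (y, t + x y/2) is constant along the integral lines of X and labels them; (x, t
  - x y/2) does the same for Y. The set consists of the points whose two lines have labels in A and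
  B.\<close>

lemma heisenberg_cylinder_sets:
  fixes A B :: "(real \<times> real) set"
  assumes AB: "A \<in> sets borel" "B \<in> sets borel"
  shows "{(x, y, t). (y, t + x * y / 2) \<in> A \<and> (x, t - x * y / 2) \<in> B} \<in> sets borel" (is "?E \<in> _")
proof -
  have [measurable]: "A \<in> sets (borel \<Otimes>\<^sub>M borel)" "B \<in> sets (borel \<Otimes>\<^sub>M borel)"
    unfolding borel_prod by (rule AB)+
  have "{p \<in> space (borel \<Otimes>\<^sub>M borel \<Otimes>\<^sub>M borel).
      (fst (snd p), snd (snd p) + fst p * fst (snd p) / 2) \<in> A \<and>
      (fst p, snd (snd p) - fst p * fst (snd p) / 2) \<in> B} \<in> sets (borel \<Otimes>\<^sub>M borel \<Otimes>\<^sub>M borel)"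
    by measurable
  moreover have "?E = {p. (fst (snd p), snd (snd p) + fst p * fst (snd p) / 2) \<in> A \<and>
      (fst p, snd (snd p) - fst p * fst (snd p) / 2) \<in> B}"
    by auto
  ultimately show "?E \<in> sets borel"
    unfolding borel_prod by simp
qed

text \<open>With \<tau> = t - x y/2 the first condition reads (y, \<tau> + x y) \<in> A, so the
  measure is the integral over B of the length \<open>N\<close> of the part of A on the line with
  slope x and intercept \<tau>. The self-interaction bound is then integrated over (x,
  \<tau>).\<close>

lemma heisenberg_loomis_whitney_weighted:
  fixes A B :: "(real \<times> real) set"
  assumes AB: "A \<in> sets borel" "B \<in> sets borel" and r: "r > 0"
  shows "emeasure lborel {(x, y, t). (y, t + x * y / 2) \<in> A \<and> (x, t - x * y / 2) \<in> B}
    \<le> ennreal r * emeasure lborel B + ennreal (8 / r\<^sup>2) * (emeasure lborel A * emeasure lborel A)"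
proof -
  define a b :: "real \<times> real \<Rightarrow> ennreal" where "a = indicator A" and "b = indicator B"
  have bb: "b \<in> borel_measurable borel" and "a \<in> borel_measurable borel"
    using AB by (simp_all add: a_def b_def)
  then have [measurable]: "a \<in> borel_measurable (borel \<Otimes>\<^sub>M borel)" "b \<in> borel_measurable (borel \<Otimes>\<^sub>M borel)"
    by (simp_all add: borel_prod)
  have [measurable]: "A \<in> sets (borel \<Otimes>\<^sub>M borel)" "B \<in> sets (borel \<Otimes>\<^sub>M borel)"
    unfolding borel_prod by (rule AB)+
  define E where "E = {(x, y, t). (y, t + x * y / 2) \<in> A \<and> (x, t - x * y / 2) \<in> B}"
  have E: "E \<in> sets borel" unfolding E_def by (rule heisenberg_cylinder_sets[OF AB])
  define N where "N = (\<lambda>x \<tau>. emeasure lborel {y. (y, \<tau> + x * y) \<in> A})"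
  define Q where "Q = (\<lambda>x \<tau>. \<integral>\<^sup>+y. \<integral>\<^sup>+y'. a (y, \<tau> + x * y) * a (y', \<tau> + x * y') * ennreal \<bar>y' - y\<bar> \<partial>lborel \<partial>lborel)"
  have [measurable]: "(\<lambda>(x, \<tau>). Q x \<tau>) \<in> borel_measurable (borel \<Otimes>\<^sub>M borel)"
    unfolding Q_def by measurable
  have NQ: "N x \<tau> \<le> ennreal r + ennreal (8 / r\<^sup>2) * Q x \<tau>" for x \<tau>
  proof -
    have "{y \<in> space borel. (y, \<tau> + x * y) \<in> A} \<in> sets borel" by measurable
    then have "{y. (y, \<tau> + x * y) \<in> A} \<in> sets borel" by simp
    from emeasure_le_self_interaction[OF this r] show ?thesis
      by (simp add: N_def Q_def a_def indicator_def)
  qed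
  have Na: "(\<integral>\<^sup>+y. a (y, \<tau> + x * y) \<partial>lborel) = N x \<tau>" for x \<tau>
  proof -
    have "{y \<in> space borel. (y, \<tau> + x * y) \<in> A} \<in> sets borel" by measurable
    then have "(\<integral>\<^sup>+y. indicator {y. (y, \<tau> + x * y) \<in> A} y \<partial>lborel) = N x \<tau>"
      by (simp add: N_def)
    then show ?thesis by (simp add: a_def indicator_def)
  qed
  have "emeasure lborel E = (\<integral>\<^sup>+p. indicator E p \<partial>lborel)" using E by simp
  also have "\<dots> = (\<integral>\<^sup>+x. \<integral>\<^sup>+y. \<integral>\<^sup>+t. indicator E (x, y, t) \<partial>lborel \<partial>lborel \<partial>lborel)"
    using E by (intro nn_integral_lborel_triple) simp
  also have "\<dots> = (\<integral>\<^sup>+x. \<integral>\<^sup>+y. \<integral>\<^sup>+t. a (y, t + x * y / 2) * b (x, t - x * y / 2) \<partial>lborel \<partial>lborel \<partial>lborel)"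
    by (intro nn_integral_cong) (auto simp: E_def a_def b_def indicator_def)
  also have "\<dots> = (\<integral>\<^sup>+x. \<integral>\<^sup>+y. \<integral>\<^sup>+\<tau>. a (y, \<tau> + x * y) * b (x, \<tau>) \<partial>lborel \<partial>lborel \<partial>lborel)"
  proof (rule nn_integral_cong, rule nn_integral_cong)
    fix x y :: real
    have "(\<lambda>t. a (y, t + x * y / 2) * b (x, t - x * y / 2)) \<in> borel_measurable borel"
      by measurable
    from nn_integral_lborel_shift[OF this, of "x * y / 2"]
    show "(\<integral>\<^sup>+t. a (y, t + x * y / 2) * b (x, t - x * y / 2) \<partial>lborel)
      = (\<integral>\<^sup>+\<tau>. a (y, \<tau> + x * y) * b (x, \<tau>) \<partial>lborel)"
      by (simp add: add.assoc)
  qed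
  also have "\<dots> = (\<integral>\<^sup>+x. \<integral>\<^sup>+\<tau>. \<integral>\<^sup>+y. a (y, \<tau> + x * y) * b (x, \<tau>) \<partial>lborel \<partial>lborel \<partial>lborel)"
    by (rule nn_integral_cong, rule lborel_pair.Fubini') measurable
  also have "\<dots> = (\<integral>\<^sup>+x. \<integral>\<^sup>+\<tau>. N x \<tau> * b (x, \<tau>) \<partial>lborel \<partial>lborel)"
    by (simp add: nn_integral_multc Na)
  \<comment> \<open>The indicator of B is kept with r, where it yields |B|, and is dropped from
    \<open>Q\<close>, whose integral over all lines is at most |A|^2.\<close>
  also have "\<dots> \<le> (\<integral>\<^sup>+x. \<integral>\<^sup>+\<tau>. ennreal r * b (x, \<tau>) + ennreal (8 / r\<^sup>2) * Q x \<tau> \<partial>lborel \<partial>lborel)"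
  proof (intro nn_integral_mono)
    fix x \<tau>
    show "N x \<tau> * b (x, \<tau>) \<le> ennreal r * b (x, \<tau>) + ennreal (8 / r\<^sup>2) * Q x \<tau>"
      using NQ[of x \<tau>] by (auto simp: b_def indicator_def)
  qed
  also have "\<dots> = ennreal r * (\<integral>\<^sup>+x. \<integral>\<^sup>+\<tau>. b (x, \<tau>) \<partial>lborel \<partial>lborel)
      + ennreal (8 / r\<^sup>2) * (\<integral>\<^sup>+x. \<integral>\<^sup>+\<tau>. Q x \<tau> \<partial>lborel \<partial>lborel)"
    by (simp add: nn_integral_add nn_integral_cmult)
  also have "(\<integral>\<^sup>+x. \<integral>\<^sup>+\<tau>. b (x, \<tau>) \<partial>lborel \<partial>lborel) = emeasure lborel B"
    using AB nn_integral_lborel_pair[OF bb] by (simp add: b_def)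
  also have "(\<integral>\<^sup>+x. \<integral>\<^sup>+\<tau>. Q x \<tau> \<partial>lborel \<partial>lborel) \<le> emeasure lborel A * emeasure lborel A"
    unfolding Q_def a_def by (rule line_self_interaction_le[OF AB(1)])
  finally show ?thesis unfolding E_def by (simp add: mult_left_mono add_left_mono)
qed

lemma heisenberg_loomis_whitney_pos:
  fixes A B :: "(real \<times> real) set"
  assumes AB: "A \<in> sets borel" "B \<in> sets borel"
    and \<alpha>: "\<alpha> > 0" "emeasure lborel A \<le> ennreal \<alpha>" and \<beta>: "\<beta> > 0" "emeasure lborel B \<le> ennreal \<beta>"
  shows "emeasure lborel {(x, y, t). (y, t + x * y / 2) \<in> A \<and> (x, t - x * y / 2) \<in> B}
    \<le> ennreal (9 * (\<alpha> * \<beta>) powr (2 / 3))" (is "?I \<le> _")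
proof -
  \<comment> \<open>This r balances the two terms of the weighted inequality: r \<beta> and
    \<alpha>^2/r^2 both equal (\<alpha> \<beta>)^(2/3), whence the constant 1 + 8 = 9.\<close>
  define r where "r = \<alpha> powr (2 / 3) * \<beta> powr (- 1 / 3)"
  have r: "r > 0" using \<alpha> \<beta> by (simp add: r_def)
  have 1: "r * \<beta> = (\<alpha> * \<beta>) powr (2 / 3)"
  proof -
    have "r * \<beta> = \<alpha> powr (2 / 3) * (\<beta> powr (- 1 / 3) * \<beta> powr 1)"
      using \<beta> by (simp add: r_def)
    also have "\<beta> powr (- 1 / 3) * \<beta> powr 1 = \<beta> powr (2 / 3)"
      using powr_add[of \<beta> "- 1 / 3" 1] by simp
    finally show ?thesis using \<alpha> \<beta> by (simp add: powr_mult)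
  qed
  have 2: "8 / r\<^sup>2 * (\<alpha> * \<alpha>) = 8 * (\<alpha> * \<beta>) powr (2 / 3)"
  proof -
    have "r\<^sup>2 = \<alpha> powr (4 / 3) * \<beta> powr (- 2 / 3)"
      using \<alpha> \<beta> by (simp add: r_def power_mult_distrib powr_power)
    moreover have "\<alpha> * \<alpha> = \<alpha> powr (4 / 3) * \<alpha> powr (2 / 3)"
      using \<alpha> by (simp flip: powr_add) (simp add: powr_numeral power2_eq_square)
    moreover have "\<beta> powr (2 / 3) * \<beta> powr (- 2 / 3) = 1"
      using \<beta> by (simp flip: powr_add)
    ultimately show ?thesis using \<alpha> \<beta> by (simp add: powr_mult field_simps)
  qed
  have "?I \<le> ennreal r * emeasure lborel B + ennreal (8 / r\<^sup>2) * (emeasure lborel A * emeasure lborel A)"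
    by (rule heisenberg_loomis_whitney_weighted[OF AB r])
  also have "\<dots> \<le> ennreal r * ennreal \<beta> + ennreal (8 / r\<^sup>2) * (ennreal \<alpha> * ennreal \<alpha>)"
    by (intro add_mono mult_mono \<alpha> \<beta> order_refl) auto
  also have "\<dots> = ennreal (r * \<beta> + 8 / r\<^sup>2 * (\<alpha> * \<alpha>))"
    using \<alpha>(1) \<beta>(1) r by (simp add: ennreal_plus[symmetric] ennreal_mult[symmetric] del: ennreal_plus)
  also have "r * \<beta> + 8 / r\<^sup>2 * (\<alpha> * \<alpha>) = 9 * (\<alpha> * \<beta>) powr (2 / 3)"
    unfolding 1 2 by simp
  finally show ?thesis .
qed

text \<open>The balancing r requires positive bounds. Null sets are covered by passing from \<alpha>
  + \<delta>, \<beta> + \<delta> to the limit \<delta> \<rightarrow> 0.\<close>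

lemma heisenberg_loomis_whitney:
  fixes A B :: "(real \<times> real) set"
  assumes AB: "A \<in> sets borel" "B \<in> sets borel"
    and \<alpha>: "\<alpha> \<ge> 0" "emeasure lborel A \<le> ennreal \<alpha>" and \<beta>: "\<beta> \<ge> 0" "emeasure lborel B \<le> ennreal \<beta>"
  shows "emeasure lborel {(x, y, t). (y, t + x * y / 2) \<in> A \<and> (x, t - x * y / 2) \<in> B}
    \<le> ennreal (9 * (\<alpha> * \<beta>) powr (2 / 3))" (is "?I \<le> _")
proof (rule tendsto_lowerbound)
  show "((\<lambda>\<delta>. ennreal (9 * ((\<alpha> + \<delta>) * (\<beta> + \<delta>)) powr (2 / 3))) \<longlongrightarrow>
      ennreal (9 * (\<alpha> * \<beta>) powr (2 / 3))) (at_right 0)"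
  proof (intro tendsto_ennrealI tendsto_mult tendsto_const)
    have "((\<lambda>\<delta>. (\<alpha> + \<delta>) * (\<beta> + \<delta>)) \<longlongrightarrow> (\<alpha> + 0) * (\<beta> + 0)) (at_right 0)"
      by (intro tendsto_intros)
    then show "((\<lambda>\<delta>. ((\<alpha> + \<delta>) * (\<beta> + \<delta>)) powr (2 / 3)) \<longlongrightarrow> (\<alpha> * \<beta>) powr (2 / 3)) (at_right 0)"
      by (intro tendsto_powr') (use \<alpha> \<beta> in \<open>auto simp: eventually_at_filter\<close>)
  qed
  show "\<forall>\<^sub>F \<delta> in at_right 0. ?I \<le> ennreal (9 * ((\<alpha> + \<delta>) * (\<beta> + \<delta>)) powr (2 / 3))"
    unfolding eventually_at_filter
  proof (intro always_eventually allI impI heisenberg_loomis_whitney_pos AB)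
    fix \<delta> :: real assume "\<delta> \<noteq> 0" "\<delta> \<in> {0<..}"
    then show "0 < \<alpha> + \<delta>" "0 < \<beta> + \<delta>" "emeasure lborel A \<le> ennreal (\<alpha> + \<delta>)" "emeasure lborel B \<le> ennreal (\<beta> + \<delta>)"
      using \<alpha>(1) \<beta>(1) by (auto intro!: order_trans[OF \<alpha>(2) ennreal_leI] order_trans[OF \<beta>(2) ennreal_leI]
          simp del: ennreal_plus)
  qed
qed simp

subsection \<open>Continuous functions with horizontal upper gradients\<close>

text \<open>Here q is the first point after s1 where k reaches d, and p the last point before q
  where k is at most c. Strictly between them neither level is attained.\<close>

lemma crossing_interval_ordered:
  fixes k :: "real \<Rightarrow> real"
  assumes k: "continuous_on UNIV k" and s: "s1 \<le> s0" "k s1 \<le> c" "d \<le> k s0"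
  obtains p q where "p \<le> q" "k p \<le> c" "d \<le> k q" "\<And>r. p < r \<Longrightarrow> r < q \<Longrightarrow> c < k r \<and> k r < d"
proof -
  have cl: "closed {s. d \<le> k s}" "closed {s. k s \<le> c}"
    using k by (auto intro!: closed_Collect_le continuous_on_const)
  have "compact ({s1..s0} \<inter> {s. d \<le> k s})" "{s1..s0} \<inter> {s. d \<le> k s} \<noteq> {}"
    using cl s by (auto intro: compact_Int_closed)
  from compact_attains_inf[OF this] obtain q
    where q: "s1 \<le> q" "q \<le> s0" "d \<le> k q" "\<And>r. s1 \<le> r \<Longrightarrow> r \<le> s0 \<Longrightarrow> d \<le> k r \<Longrightarrow> q \<le> r"
    by auto
  have "compact ({s1..q} \<inter> {s. k s \<le> c})" "{s1..q} \<inter> {s. k s \<le> c} \<noteq> {}"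
    using cl s q by (auto intro: compact_Int_closed)
  from compact_attains_sup[OF this] obtain p
    where p: "s1 \<le> p" "p \<le> q" "k p \<le> c" "\<And>r. s1 \<le> r \<Longrightarrow> r \<le> q \<Longrightarrow> k r \<le> c \<Longrightarrow> r \<le> p"
    by auto
  have "c < k r \<and> k r < d" if "p < r" "r < q" for r
  proof (rule conjI)
    show "c < k r" using p(1) p(4)[of r] that by fastforce
    show "k r < d" using q(2) q(4)[of r] p(1) that by fastforce
  qed
  then show ?thesis using that p q by blast
qed

text \<open>The case s1 > s0 follows by the reflection r \<mapsto> - r. The absolute value of the
  increment removes the orientation from the conclusion.\<close>

lemma crossing_interval:
  fixes k :: "real \<Rightarrow> real"
  assumes k: "continuous_on UNIV k" and s: "k s1 \<le> c" "d \<le> k s0"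
  obtains p q where "p \<le> q" "d - c \<le> \<bar>k q - k p\<bar>" "\<And>r. p < r \<Longrightarrow> r < q \<Longrightarrow> c < k r \<and> k r < d"
proof (cases "s1 \<le> s0")
  case True
  obtain p q where pq: "p \<le> q" "k p \<le> c" "d \<le> k q" "\<And>r. p < r \<Longrightarrow> r < q \<Longrightarrow> c < k r \<and> k r < d"
    by (rule crossing_interval_ordered[OF k True s]) blast
  show ?thesis by (rule that[OF pq(1) _ pq(4)]) (use pq(2,3) in auto)
next
  case False
  have ck: "continuous_on UNIV (\<lambda>r. k (- r))"
    by (rule continuous_on_compose2[OF k]) (auto intro: continuous_intros)
  have s': "- s1 \<le> - s0" "k (- (- s1)) \<le> c" "d \<le> k (- (- s0))"
    using False s by auto
  obtain p q where pq: "p \<le> q" "k (- p) \<le> c" "d \<le> k (- q)"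
      "\<And>r. p < r \<Longrightarrow> r < q \<Longrightarrow> c < k (- r) \<and> k (- r) < d"
    by (rule crossing_interval_ordered[OF ck s']) blast
  show ?thesis
  proof (rule that[of "- q" "- p"])
    show "c < k r \<and> k r < d" if "- q < r" "r < - p" for r
      using pq(4)[of "- r"] that by simp
  qed (use pq in auto)
qed

text \<open>An integrable function on the line cannot keep \<bar>h\<bar> above c everywhere. Hence
  \<bar>h\<bar> passes between the levels 2c and c on some interval, and an upper gradient has
  integral at least c over that interval, whose interior lies in the layer.\<close>

lemma oscillation_between_levels:
  fixes h :: "real \<Rightarrow> real" and G :: "real \<Rightarrow> ennreal"
  assumes h: "continuous_on UNIV h" and fin: "(\<integral>\<^sup>+r. ennreal \<bar>h r\<bar> \<partial>lborel) \<noteq> \<infinity>"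
    and grad: "\<And>a b. a \<le> b \<Longrightarrow> ennreal \<bar>h b - h a\<bar> \<le> (\<integral>\<^sup>+r. G r * indicator {a..b} r \<partial>lborel)"
    and c: "c > 0" and s: "2 * c \<le> \<bar>h s\<bar>"
  shows "ennreal c \<le> (\<integral>\<^sup>+r. G r * indicator {r. c < \<bar>h r\<bar> \<and> \<bar>h r\<bar> < 2 * c} r \<partial>lborel)"
proof -
  obtain s1 where s1: "\<bar>h s1\<bar> \<le> c"
  proof (rule ccontr)
    assume "\<not> thesis"
    then have "c \<le> \<bar>h r\<bar>" for r using that[of r] by linarith
    then have "(\<integral>\<^sup>+r. ennreal c \<partial>(lborel :: real measure)) \<le> (\<integral>\<^sup>+r. ennreal \<bar>h r\<bar> \<partial>lborel)"
      by (intro nn_integral_mono ennreal_leI)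
    moreover have "(\<integral>\<^sup>+r. ennreal c \<partial>(lborel :: real measure)) = \<infinity>"
      using c by (simp add: ennreal_mult_top)
    ultimately show False using fin by (simp add: top_unique)
  qed
  obtain p q where pq: "p \<le> q" "2 * c - c \<le> \<bar>\<bar>h q\<bar> - \<bar>h p\<bar>\<bar>"
      "\<And>r. p < r \<Longrightarrow> r < q \<Longrightarrow> c < \<bar>h r\<bar> \<and> \<bar>h r\<bar> < 2 * c"
    by (rule crossing_interval[of "\<lambda>r. \<bar>h r\<bar>" s1 c "2 * c" s]) (use h s s1 in \<open>auto intro: continuous_intros\<close>)
  have "ennreal c \<le> ennreal \<bar>h q - h p\<bar>"
    using pq(2) abs_triangle_ineq3[of "h q" "h p"] by (intro ennreal_leI) linarith
  also have "\<dots> \<le> (\<integral>\<^sup>+r. G r * indicator {p..q} r \<partial>lborel)" by (rule grad[OF pq(1)])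
  also have "\<dots> \<le> (\<integral>\<^sup>+r. G r * indicator {r. c < \<bar>h r\<bar> \<and> \<bar>h r\<bar> < 2 * c} r \<partial>lborel)"
  proof (rule nn_integral_mono_AE)
    \<comment> \<open>The endpoints may lie outside the open layer, but they form a null
      set.\<close>
    have "AE r in lborel. r \<noteq> p" "AE r in lborel. r \<noteq> q" by (rule AE_lborel_singleton)+
    then show "AE r in lborel. G r * indicator {p..q} r \<le> G r * indicator {r. c < \<bar>h r\<bar> \<and> \<bar>h r\<bar> < 2 * c} r"
      by eventually_elim (use pq(3) in \<open>auto simp: indicator_def\<close>)
  qed
  finally show ?thesis .
qed

section \<open>From single lines to projections of superlevel sets\<close>

lemma superlevel_set_lines:
  fixes u :: "'a::euclidean_space \<Rightarrow> real" and \<Phi> :: "'b::euclidean_space \<Rightarrow> real \<Rightarrow> 'a"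
  assumes \<Phi>: "continuous_on UNIV (\<lambda>z. \<Phi> (fst z) (snd z))"
    and disint: "\<And>F. F \<in> borel_measurable borel \<Longrightarrow>
      (\<integral>\<^sup>+q. \<integral>\<^sup>+r. F (\<Phi> q r) \<partial>lborel \<partial>lborel) = (\<integral>\<^sup>+p. F p \<partial>lborel)"
    and u: "continuous_on UNIV u" and fin: "(\<integral>\<^sup>+p. ennreal \<bar>u p\<bar> \<partial>lborel) \<noteq> \<infinity>"
    and g: "g \<in> borel_measurable borel"
    and grad: "\<And>q a b. a \<le> b \<Longrightarrow>
      ennreal \<bar>u (\<Phi> q b) - u (\<Phi> q a)\<bar> \<le> (\<integral>\<^sup>+r. g (\<Phi> q r) * indicator {a..b} r \<partial>lborel)"
    and c: "c > 0"
    and x: "(\<integral>\<^sup>+p. g p * indicator {p. c < \<bar>u p\<bar> \<and> \<bar>u p\<bar> < 2 * c} p \<partial>lborel) \<le> ennreal x" "x \<ge> 0"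
  obtains A where "A \<in> sets borel" "emeasure lborel A \<le> ennreal (x / c)"
    "\<And>q s. 2 * c \<le> \<bar>u (\<Phi> q s)\<bar> \<Longrightarrow> q \<in> A"
proof -
  define D where "D = {p. c < \<bar>u p\<bar> \<and> \<bar>u p\<bar> < 2 * c}"
  have [measurable]: "u \<in> borel_measurable borel"
    using u by (rule borel_measurable_continuous_onI)
  have [measurable]: "D \<in> sets borel" unfolding D_def by measurable
  note g[measurable]
  have "(\<lambda>z. \<Phi> (fst z) (snd z)) \<in> borel_measurable borel"
    using \<Phi> by (rule borel_measurable_continuous_onI)
  then have [measurable]: "(\<lambda>z. \<Phi> (fst z) (snd z)) \<in> borel_measurable (borel \<Otimes>\<^sub>M borel)"
    by (simp add: borel_prod)
  define I where "I = (\<lambda>q. \<integral>\<^sup>+r. g (\<Phi> q r) * indicator D (\<Phi> q r) \<partial>lborel)"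
  define J where "J = (\<lambda>q. \<integral>\<^sup>+r. ennreal \<bar>u (\<Phi> q r)\<bar> \<partial>lborel)"
  have "(\<lambda>q. \<integral>\<^sup>+r. (\<lambda>p. g p * indicator D p) (\<Phi> (fst (q, r)) (snd (q, r))) \<partial>lborel) \<in> borel_measurable borel"
    "(\<lambda>q. \<integral>\<^sup>+r. (\<lambda>p. ennreal \<bar>u p\<bar>) (\<Phi> (fst (q, r)) (snd (q, r))) \<partial>lborel) \<in> borel_measurable borel"
    by measurable
  then have [measurable]: "I \<in> borel_measurable borel" "J \<in> borel_measurable borel"
    by (simp_all add: I_def J_def)
  have I: "(\<integral>\<^sup>+q. I q \<partial>lborel) \<le> ennreal x"
    using disint[of "\<lambda>p. g p * indicator D p"] x by (simp add: I_def D_def)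
  have J: "(\<integral>\<^sup>+q. J q \<partial>lborel) \<noteq> \<infinity>"
    using disint[of "\<lambda>p. ennreal \<bar>u p\<bar>"] fin by (simp add: J_def)
  define A1 where "A1 = {q. 1 \<le> ennreal (1 / c) * I q}"
  define A2 where "A2 = {q. J q = \<infinity>}"
  have [measurable]: "A1 \<in> sets borel" "A2 \<in> sets borel" unfolding A1_def A2_def by measurable
  have "emeasure lborel A1 \<le> ennreal (1 / c) * (\<integral>\<^sup>+q. I q * indicator UNIV q \<partial>lborel)"
    using nn_integral_Markov_inequality[of I UNIV lborel "ennreal (1 / c)"] by (simp add: A1_def)
  also have "\<dots> \<le> ennreal (1 / c) * ennreal x"
    using I by (intro mult_left_mono) auto
  also have "\<dots> = ennreal (x / c)" using c x(2) by (simp flip: ennreal_mult)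
  finally have A1: "emeasure lborel A1 \<le> ennreal (x / c)" .
  have A2: "emeasure lborel A2 = 0"
    using nn_integral_PInf[of J lborel] J by (simp add: A2_def vimage_def)
  have "emeasure lborel (A1 \<union> A2) \<le> emeasure lborel A1 + emeasure lborel A2"
    by (rule emeasure_subadditive) auto
  then have A: "emeasure lborel (A1 \<union> A2) \<le> ennreal (x / c)" using A1 A2 by simp
  have "q \<in> A1 \<union> A2" if s: "2 * c \<le> \<bar>u (\<Phi> q s)\<bar>" for q s
  proof (cases "J q = \<infinity>")
    case False
    have "continuous_on UNIV (\<lambda>r. u (\<Phi> q r))"
    proof (rule continuous_on_compose2[OF u])
      have "continuous_on UNIV (\<lambda>r. (q, r))" by (intro continuous_intros)
      from continuous_on_compose2[OF \<Phi> this] show "continuous_on UNIV (\<Phi> q)" by simp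
    qed auto
    from oscillation_between_levels[OF this False[unfolded J_def] grad c s]
    have "ennreal c \<le> I q"
      by (simp add: I_def D_def indicator_def)
    then have "ennreal (1 / c) * ennreal c \<le> ennreal (1 / c) * I q" by (rule mult_left_mono) simp
    then show ?thesis using c by (simp add: A1_def flip: ennreal_mult)
  qed (simp add: A2_def)
  then show ?thesis using that[of "A1 \<union> A2"] A by simp
qed

text \<open>For fixed r and y the label of an X-line differs from the height by a shift, so the
  lines foliate space with Jacobian 1.\<close>

lemma nn_integral_X_lines:
  fixes F :: "heis \<Rightarrow> ennreal"
  assumes F: "F \<in> borel_measurable borel"
  shows "(\<integral>\<^sup>+q. \<integral>\<^sup>+r. F (r, fst q, snd q - r * fst q / 2) \<partial>lborel \<partial>lborel) = (\<integral>\<^sup>+p. F p \<partial>lborel)"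
proof -
  have [measurable]: "F \<in> borel_measurable (borel \<Otimes>\<^sub>M borel \<Otimes>\<^sub>M borel)"
    using F by (simp add: borel_prod)
  have "(\<lambda>q. \<integral>\<^sup>+r. F (r, fst q, snd q - r * fst q / 2) \<partial>lborel) \<in> borel_measurable (borel \<Otimes>\<^sub>M borel)"
    by measurable
  then have "(\<integral>\<^sup>+q. \<integral>\<^sup>+r. F (r, fst q, snd q - r * fst q / 2) \<partial>lborel \<partial>lborel)
     = (\<integral>\<^sup>+y. \<integral>\<^sup>+t. \<integral>\<^sup>+r. F (r, y, t - r * y / 2) \<partial>lborel \<partial>lborel \<partial>lborel)"
    by (subst nn_integral_lborel_pair) (simp_all add: borel_prod)
  also have "\<dots> = (\<integral>\<^sup>+y. \<integral>\<^sup>+r. \<integral>\<^sup>+t. F (r, y, t - r * y / 2) \<partial>lborel \<partial>lborel \<partial>lborel)"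
    by (rule nn_integral_cong, rule lborel_pair.Fubini') measurable
  also have "\<dots> = (\<integral>\<^sup>+y. \<integral>\<^sup>+r. \<integral>\<^sup>+t. F (r, y, t) \<partial>lborel \<partial>lborel \<partial>lborel)"
  proof (rule nn_integral_cong, rule nn_integral_cong)
    fix y r :: real
    have "(\<lambda>t. F (r, y, t)) \<in> borel_measurable borel" by measurable
    from nn_integral_lborel_shift[OF this, of "- (r * y / 2)"]
    show "(\<integral>\<^sup>+t. F (r, y, t - r * y / 2) \<partial>lborel) = (\<integral>\<^sup>+t. F (r, y, t) \<partial>lborel)" by simp
  qed
  also have "\<dots> = (\<integral>\<^sup>+r. \<integral>\<^sup>+y. \<integral>\<^sup>+t. F (r, y, t) \<partial>lborel \<partial>lborel \<partial>lborel)"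
    by (rule lborel_pair.Fubini') measurable
  also have "\<dots> = (\<integral>\<^sup>+p. F p \<partial>lborel)" by (rule nn_integral_lborel_triple[OF F, symmetric])
  finally show ?thesis .
qed

lemma nn_integral_Y_lines:
  fixes F :: "heis \<Rightarrow> ennreal"
  assumes F: "F \<in> borel_measurable borel"
  shows "(\<integral>\<^sup>+q. \<integral>\<^sup>+r. F (fst q, r, snd q + fst q * r / 2) \<partial>lborel \<partial>lborel) = (\<integral>\<^sup>+p. F p \<partial>lborel)"
proof -
  have [measurable]: "F \<in> borel_measurable (borel \<Otimes>\<^sub>M borel \<Otimes>\<^sub>M borel)"
    using F by (simp add: borel_prod)
  have "(\<lambda>q. \<integral>\<^sup>+r. F (fst q, r, snd q + fst q * r / 2) \<partial>lborel) \<in> borel_measurable (borel \<Otimes>\<^sub>M borel)"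
    by measurable
  then have "(\<integral>\<^sup>+q. \<integral>\<^sup>+r. F (fst q, r, snd q + fst q * r / 2) \<partial>lborel \<partial>lborel)
     = (\<integral>\<^sup>+x. \<integral>\<^sup>+t. \<integral>\<^sup>+r. F (x, r, t + x * r / 2) \<partial>lborel \<partial>lborel \<partial>lborel)"
    by (subst nn_integral_lborel_pair) (simp_all add: borel_prod)
  also have "\<dots> = (\<integral>\<^sup>+x. \<integral>\<^sup>+r. \<integral>\<^sup>+t. F (x, r, t + x * r / 2) \<partial>lborel \<partial>lborel \<partial>lborel)"
    by (rule nn_integral_cong, rule lborel_pair.Fubini') measurable
  also have "\<dots> = (\<integral>\<^sup>+x. \<integral>\<^sup>+r. \<integral>\<^sup>+t. F (x, r, t) \<partial>lborel \<partial>lborel \<partial>lborel)"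
    by (intro nn_integral_cong nn_integral_lborel_shift) measurable
  also have "\<dots> = (\<integral>\<^sup>+p. F p \<partial>lborel)" by (rule nn_integral_lborel_triple[OF F, symmetric])
  finally show ?thesis .
qed

text \<open>For p = x/X and q = y/Y in [0, 1], the inequality 2/3 \<ge> 1/2 gives (p q)^(2/3) \<le>
  sqrt (p q) \<le> (p + q)/2. The right-hand side is linear in x and y, so it can be summed over
  disjoint layers.\<close>

lemma powr_prod_le_sum:
  fixes x y X Y :: real
  assumes "0 \<le> x" "x \<le> X" "0 \<le> y" "y \<le> Y" "X > 0" "Y > 0"
  shows "(x * y) powr (2 / 3) \<le> (X * Y) powr (2 / 3) * (x / X + y / Y)"
proof -
  define p q where "p = x / X" and "q = y / Y"
  have pq: "0 \<le> p" "p \<le> 1" "0 \<le> q" "q \<le> 1" using assms by (auto simp: p_def q_def)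
  have "(p * q) powr (2 / 3) \<le> (p * q) powr (1 / 2)"
    using pq by (intro powr_mono') (simp_all add: mult_le_one)
  also have "\<dots> = sqrt (p * q)" using pq by (simp add: powr_half_sqrt)
  also have "\<dots> \<le> (p + q) / 2" using pq by (intro arith_geo_mean_sqrt)
  also have "\<dots> \<le> p + q" using pq by simp
  finally have "(X * Y) powr (2 / 3) * (p * q) powr (2 / 3) \<le> (X * Y) powr (2 / 3) * (p + q)"
    by (rule mult_left_mono) simp
  moreover have "(x * y) powr (2 / 3) = ((X * Y) * (p * q)) powr (2 / 3)"
    using assms(5,6) by (simp add: p_def q_def)
  moreover have "\<dots> = (X * Y) powr (2 / 3) * (p * q) powr (2 / 3)"
    using assms(5,6) pq by (intro powr_mult)
  ultimately show ?thesis unfolding p_def q_def by linarith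
qed

section \<open>Summation over dyadic layers\<close>

text \<open>Horizontal derivatives enter only through integral bounds for increments along every
  X-line and every Y-line. For a mollified BV function such bounds come directly from the mollified
  measures.\<close>

locale horizontal_upper_gradients =
  fixes u :: "heis \<Rightarrow> real" and g1 g2 :: "heis \<Rightarrow> ennreal"
  assumes u: "continuous_on UNIV u" and fin: "(\<integral>\<^sup>+p. ennreal \<bar>u p\<bar> \<partial>lborel) \<noteq> \<infinity>"
    and g1[measurable]: "g1 \<in> borel_measurable borel" and g2[measurable]: "g2 \<in> borel_measurable borel"
    and grad1: "\<And>y t a b. a \<le> b \<Longrightarrow> ennreal \<bar>u (b, y, t - b * y / 2) - u (a, y, t - a * y / 2)\<bar>
      \<le> (\<integral>\<^sup>+r. g1 (r, y, t - r * y / 2) * indicator {a..b} r \<partial>lborel)"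
    and grad2: "\<And>x t a b. a \<le> b \<Longrightarrow> ennreal \<bar>u (x, b, t + x * b / 2) - u (x, a, t + x * a / 2)\<bar>
      \<le> (\<integral>\<^sup>+r. g2 (x, r, t + x * r / 2) * indicator {a..b} r \<partial>lborel)"
begin

definition layer :: "real \<Rightarrow> heis set" where
  "layer c = {p. c < \<bar>u p\<bar> \<and> \<bar>u p\<bar> < 2 * c}"

lemma borel_measurable_u [measurable]: "u \<in> borel_measurable borel"
  using u by (rule borel_measurable_continuous_onI)

lemma layer_sets [measurable]: "layer c \<in> sets borel"
  unfolding layer_def by measurable

text \<open>Each point of the superlevel set lies on an X-line and on a Y-line that both meet the
  set, so both labels lie in the small sets supplied by \<open>superlevel_set_lines\<close>.\<close>

lemma emeasure_superlevel_le:
  assumes c: "c > 0" and x: "(\<integral>\<^sup>+p. g1 p * indicator (layer c) p \<partial>lborel) \<le> ennreal x" "x \<ge> 0"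
    and y: "(\<integral>\<^sup>+p. g2 p * indicator (layer c) p \<partial>lborel) \<le> ennreal y" "y \<ge> 0"
  shows "emeasure lborel {p. 2 * c \<le> \<bar>u p\<bar>} \<le> ennreal (9 * (x / c * (y / c)) powr (2 / 3))"
proof -
  obtain A where A: "A \<in> sets borel" "emeasure lborel A \<le> ennreal (x / c)"
    "\<And>q s. 2 * c \<le> \<bar>u (s, fst q, snd q - s * fst q / 2)\<bar> \<Longrightarrow> q \<in> A"
    by (rule superlevel_set_lines[of "\<lambda>q r. (r, fst q, snd q - r * fst q / 2)" u g1 c x])
      (use u fin g1 grad1 c x in \<open>auto intro!: continuous_intros nn_integral_X_lines simp: layer_def\<close>)
  obtain B where B: "B \<in> sets borel" "emeasure lborel B \<le> ennreal (y / c)"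
    "\<And>q s. 2 * c \<le> \<bar>u (fst q, s, snd q + fst q * s / 2)\<bar> \<Longrightarrow> q \<in> B"
    by (rule superlevel_set_lines[of "\<lambda>q r. (fst q, r, snd q + fst q * r / 2)" u g2 c y])
      (use u fin g2 grad2 c y in \<open>auto intro!: continuous_intros nn_integral_Y_lines simp: layer_def\<close>)
  define E where "E = {(x, y, t). (y, t + x * y / 2) \<in> A \<and> (x, t - x * y / 2) \<in> B}"
  have "{p. 2 * c \<le> \<bar>u p\<bar>} \<subseteq> E"
  proof
    fix p assume "p \<in> {p. 2 * c \<le> \<bar>u p\<bar>}"
    then show "p \<in> E"
      using A(3)[of "fst p" "(fst (snd p), snd (snd p) + fst p * fst (snd p) / 2)"]
        B(3)[of "(fst p, snd (snd p) - fst p * fst (snd p) / 2)" "fst (snd p)"]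
      by (simp add: E_def case_prod_beta)
  qed
  moreover have "E \<in> sets borel" unfolding E_def by (rule heisenberg_cylinder_sets[OF A(1) B(1)])
  ultimately have "emeasure lborel {p. 2 * c \<le> \<bar>u p\<bar>} \<le> emeasure lborel E"
    by (intro emeasure_mono) auto
  also have "\<dots> \<le> ennreal (9 * (x / c * (y / c)) powr (2 / 3))"
    unfolding E_def using A B c x y by (intro heisenberg_loomis_whitney) auto
  finally show ?thesis .
qed

text \<open>A point lies in at most one dyadic layer, namely the one with index the floor of log 2
  \<bar>u p\<bar>. The sum is an integral against counting measure so that it can be exchanged with
  the Lebesgue integral.\<close>

lemma sum_layers_le:
  assumes [measurable]: "g \<in> borel_measurable borel"
  shows "(\<integral>\<^sup>+k. \<integral>\<^sup>+p. g p * indicator (layer (2 powr real_of_int k)) p \<partial>lborel \<partial>count_space UNIV) \<le> (\<integral>\<^sup>+p. g p \<partial>lborel)"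
proof -
  have "(\<integral>\<^sup>+k. \<integral>\<^sup>+p. g p * indicator (layer (2 powr real_of_int k)) p \<partial>lborel \<partial>count_space UNIV)
    = (\<integral>\<^sup>+p. \<integral>\<^sup>+k. g p * indicator (layer (2 powr real_of_int k)) p \<partial>count_space UNIV \<partial>lborel)"
    by (rule nn_integral_count_space_nn_integral[symmetric]) auto
  also have "\<dots> \<le> (\<integral>\<^sup>+p. \<integral>\<^sup>+k. g p * indicator {\<lfloor>log 2 \<bar>u p\<bar>\<rfloor>} k \<partial>count_space UNIV \<partial>lborel)"
  proof (intro nn_integral_mono mult_left_mono)
    fix p and k :: int
    have "k = \<lfloor>log 2 \<bar>u p\<bar>\<rfloor>" if k: "2 powr real_of_int k < \<bar>u p\<bar>" "\<bar>u p\<bar> < 2 * 2 powr real_of_int k"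
    proof -
      have "\<bar>u p\<bar> > 0" using k(1) powr_gt_zero[of 2 k] by linarith
      moreover have "\<bar>u p\<bar> < 2 powr (real_of_int k + 1)" using k(2) by (simp add: powr_add mult.commute)
      ultimately have "k < log 2 \<bar>u p\<bar>" "log 2 \<bar>u p\<bar> < k + 1"
        using k(1) by (auto simp: less_log_iff log_less_iff)
      then show ?thesis by linarith
    qed
    then show "indicator (layer (2 powr real_of_int k)) p \<le> (indicator {\<lfloor>log 2 \<bar>u p\<bar>\<rfloor>} k :: ennreal)"
      by (auto simp: layer_def indicator_def)
  qed simp
  also have "\<dots> = (\<integral>\<^sup>+p. g p \<partial>lborel)"
    by (simp add: nn_integral_cmult)
  finally show ?thesis .
qed

lemma powr_le_sum_superlevels:
  "ennreal (\<bar>u p\<bar> powr (4 / 3)) \<le> (\<integral>\<^sup>+k. ennreal ((4 * 2 powr real_of_int k) powr (4 / 3)) *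
     indicator {p. 2 * 2 powr real_of_int k \<le> \<bar>u p\<bar>} p \<partial>count_space UNIV)"
proof (cases "u p = 0")
  case False
  \<comment> \<open>The shift by 1 is due to the superlevel set of index k beginning at 2^(k+1). For
    this k one has 2^(k+1) \<le> \<bar>u p\<bar> < 2^(k+2), and this single term of the sum
    suffices.\<close>
  define k where "k = \<lfloor>log 2 \<bar>u p\<bar>\<rfloor> - 1"
  have "real_of_int k + 1 \<le> log 2 \<bar>u p\<bar>" "log 2 \<bar>u p\<bar> < real_of_int k + 2"
    unfolding k_def by linarith+
  then have "2 powr (real_of_int k + 1) \<le> \<bar>u p\<bar>" "\<bar>u p\<bar> < 2 powr (real_of_int k + 2)"
    using False by (simp_all add: le_log_iff log_less_iff)
  then have k: "2 * 2 powr real_of_int k \<le> \<bar>u p\<bar>" "\<bar>u p\<bar> \<le> 4 * 2 powr real_of_int k"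
    by (simp_all add: powr_add)
  have "ennreal (\<bar>u p\<bar> powr (4 / 3)) \<le> ennreal ((4 * 2 powr real_of_int k) powr (4 / 3))"
    using k by (intro ennreal_leI powr_mono2) auto
  also have "\<dots> = ennreal ((4 * 2 powr real_of_int k) powr (4 / 3)) * indicator {p. 2 * 2 powr real_of_int k \<le> \<bar>u p\<bar>} p"
    using k by simp
  also have "\<dots> \<le> (\<integral>\<^sup>+k. ennreal ((4 * 2 powr real_of_int k) powr (4 / 3)) *
     indicator {p. 2 * 2 powr real_of_int k \<le> \<bar>u p\<bar>} p \<partial>count_space UNIV)"
    by (rule nn_integral_ge_point) simp
  finally show ?thesis .
qed simp

text \<open>The power integral is bounded by a sum over dyadic superlevel sets. Each term is at most
  a linear combination of the gradient masses \<xi> k and \<eta> k of its layer, and these masses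
  sum to at most X and Y.\<close>

lemma Sobolev_inequality:
  assumes X: "X > 0" "(\<integral>\<^sup>+p. g1 p \<partial>lborel) \<le> ennreal X" and Y: "Y > 0" "(\<integral>\<^sup>+p. g2 p \<partial>lborel) \<le> ennreal Y"
  shows "(\<integral>\<^sup>+p. ennreal (\<bar>u p\<bar> powr (4 / 3)) \<partial>lborel) \<le> ennreal (144 * (X * Y) powr (2 / 3))"
proof -
  define \<xi> \<eta> :: "int \<Rightarrow> ennreal" where
    "\<xi> = (\<lambda>k. \<integral>\<^sup>+p. g1 p * indicator (layer (2 powr real_of_int k)) p \<partial>lborel)" and
    "\<eta> = (\<lambda>k. \<integral>\<^sup>+p. g2 p * indicator (layer (2 powr real_of_int k)) p \<partial>lborel)"
  \<comment> \<open>72 = 9 * 8, with 9 from the Loomis--Whitney bound and 8 = 4^(3/2) as an upper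
    bound for 4^(4/3). The two gradients contribute K each, which gives 144.\<close>
  define K where "K = 72 * (X * Y) powr (2 / 3)"
  have \<xi>le: "\<xi> k \<le> ennreal X" for k
    unfolding \<xi>_def by (rule order_trans[OF _ X(2)], rule nn_integral_mono) (auto simp: indicator_def)
  have \<eta>le: "\<eta> k \<le> ennreal Y" for k
    unfolding \<eta>_def by (rule order_trans[OF _ Y(2)], rule nn_integral_mono) (auto simp: indicator_def)
  have level: "ennreal ((4 * 2 powr real_of_int k) powr (4 / 3)) * emeasure lborel {p. 2 * 2 powr real_of_int k \<le> \<bar>u p\<bar>}
    \<le> ennreal (K / X) * \<xi> k + ennreal (K / Y) * \<eta> k" for k :: int
  proof -
    obtain x where x: "x \<ge> 0" "\<xi> k = ennreal x" "x \<le> X"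
      using \<xi>le[of k] X(1) by (cases "\<xi> k") (auto simp: top_unique)
    obtain y where y: "y \<ge> 0" "\<eta> k = ennreal y" "y \<le> Y"
      using \<eta>le[of k] Y(1) by (cases "\<eta> k") (auto simp: top_unique)
    define c :: real where "c = 2 powr real_of_int k"
    have c: "c > 0" by (simp add: c_def)
    have "ennreal ((4 * c) powr (4 / 3)) * emeasure lborel {p. 2 * c \<le> \<bar>u p\<bar>}
      \<le> ennreal ((4 * c) powr (4 / 3)) * ennreal (9 * (x / c * (y / c)) powr (2 / 3))"
      using x y c by (intro mult_left_mono emeasure_superlevel_le) (auto simp: \<xi>_def \<eta>_def c_def)
    also have "\<dots> = ennreal ((4 * c) powr (4 / 3) * (9 * (x / c * (y / c)) powr (2 / 3)))"
      by (simp add: ennreal_mult)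
    also have "\<dots> \<le> ennreal (K * (x / X + y / Y))"
    proof (rule ennreal_leI)
      \<comment> \<open>The powers of c cancel: 4/3 is the exponent for which the level estimate
        does not depend on the level.\<close>
      have "(c * c) powr (2 / 3) = c powr (4 / 3)"
        using c by (simp add: powr_mult flip: powr_add)
      then have "(4 * c) powr (4 / 3) * (9 * (x / c * (y / c)) powr (2 / 3)) = 9 * 4 powr (4 / 3) * (x * y) powr (2 / 3)"
        using c x y by (simp add: powr_mult powr_divide)
      also have "\<dots> \<le> 9 * 8 * ((X * Y) powr (2 / 3) * (x / X + y / Y))"
      proof (intro mult_mono powr_prod_le_sum x y X Y order_refl)
        have "(4::real) powr (4 / 3) \<le> 4 powr (3 / 2)" by (intro powr_mono) auto
        also have "(4::real) powr (3 / 2) = 8"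
          using powr_powr[of 2 2 "3/2::real"] by (simp add: powr_numeral)
        finally show "(4::real) powr (4 / 3) \<le> 8" .
      qed auto
      finally show "(4 * c) powr (4 / 3) * (9 * (x / c * (y / c)) powr (2 / 3)) \<le> K * (x / X + y / Y)"
        by (simp add: K_def mult.assoc)
    qed
    also have "\<dots> = ennreal (K / X) * \<xi> k + ennreal (K / Y) * \<eta> k"
      using x y X(1) Y(1) by (simp add: K_def distrib_left flip: ennreal_mult ennreal_plus)
    finally show ?thesis unfolding c_def .
  qed
  have "(\<integral>\<^sup>+p. ennreal (\<bar>u p\<bar> powr (4 / 3)) \<partial>lborel)
    \<le> (\<integral>\<^sup>+p. \<integral>\<^sup>+k. ennreal ((4 * 2 powr real_of_int k) powr (4 / 3)) *
     indicator {p. 2 * 2 powr real_of_int k \<le> \<bar>u p\<bar>} p \<partial>count_space UNIV \<partial>lborel)"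
    by (intro nn_integral_mono powr_le_sum_superlevels)
  also have "\<dots> = (\<integral>\<^sup>+k. \<integral>\<^sup>+p. ennreal ((4 * 2 powr real_of_int k) powr (4 / 3)) *
     indicator {p. 2 * 2 powr real_of_int k \<le> \<bar>u p\<bar>} p \<partial>lborel \<partial>count_space UNIV)"
    by (rule nn_integral_count_space_nn_integral) auto
  also have "\<dots> = (\<integral>\<^sup>+k. ennreal ((4 * 2 powr real_of_int k) powr (4 / 3)) *
     emeasure lborel {p. 2 * 2 powr real_of_int k \<le> \<bar>u p\<bar>} \<partial>count_space UNIV)"
    by (intro nn_integral_cong nn_integral_cmult_indicator) simp
  also have "\<dots> \<le> (\<integral>\<^sup>+k. ennreal (K / X) * \<xi> k + ennreal (K / Y) * \<eta> k \<partial>count_space UNIV)"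
    by (intro nn_integral_mono level)
  also have "\<dots> = ennreal (K / X) * (\<integral>\<^sup>+k. \<xi> k \<partial>count_space UNIV) + ennreal (K / Y) * (\<integral>\<^sup>+k. \<eta> k \<partial>count_space UNIV)"
    by (simp add: nn_integral_add nn_integral_cmult)
  also have "\<dots> \<le> ennreal (K / X) * ennreal X + ennreal (K / Y) * ennreal Y"
    unfolding \<xi>_def \<eta>_def
    by (intro add_mono mult_left_mono order_trans[OF sum_layers_le X(2)] order_trans[OF sum_layers_le Y(2)]) auto
  also have "\<dots> = ennreal (144 * (X * Y) powr (2 / 3))"
    using X(1) Y(1) by (simp add: K_def flip: ennreal_mult ennreal_plus)
  finally show ?thesis .
qed

end

subsection \<open>Translations in $L^1$\<close>

fun heis_mult :: "heis \<Rightarrow> heis \<Rightarrow> heis" (infixl \<open>\<odot>\<close> 70) where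
  "(x, y, t) \<odot> (x', y', t') = (x + x', y + y', t + t' + (x * y' - y * x') / 2)"

lemma heis_mult_fst_snd:
  "p \<odot> q = (fst p + fst q, fst (snd p) + fst (snd q),
    snd (snd p) + snd (snd q) + (fst p * fst (snd q) - fst (snd p) * fst q) / 2)"
  by (cases p rule: prod_cases3, cases q rule: prod_cases3) simp

lemma heis_mult_assoc: "(p \<odot> q) \<odot> r = p \<odot> (q \<odot> r)"
  by (simp add: heis_mult_fst_snd field_simps)

lemma heis_mult_inverse_left [simp]: "- p \<odot> (p \<odot> q) = q"
  by (simp add: heis_mult_fst_snd prod_eq_iff field_simps)

lemma heis_mult_minus: "- (p \<odot> q) = - q \<odot> - p"
  by (simp add: heis_mult_fst_snd prod_eq_iff field_simps)

lemma continuous_on_heis_mult [continuous_intros]: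
  "continuous_on S f \<Longrightarrow> continuous_on S g \<Longrightarrow> continuous_on S (\<lambda>p. f p \<odot> g p)"
  unfolding heis_mult_fst_snd by (intro continuous_intros) auto

lemma borel_measurable_heis_mult [measurable (raw)]:
  assumes f: "f \<in> borel_measurable M" and g: "g \<in> borel_measurable M"
  shows "(\<lambda>p. f p \<odot> g p) \<in> borel_measurable M"
proof -
  have "continuous_on UNIV (\<lambda>z. fst z \<odot> snd z)"
    by (intro continuous_intros)
  from borel_measurable_continuous_Pair[OF f g this] show ?thesis by simp
qed

text \<open>Left translation, right translation and w \<mapsto> p \<odot> - w are all triangular
  affine maps with diagonal entries e = 1 or e = -1. Substituting in t, y and x in turn treats the
  three at once.\<close>

lemma nn_integral_heis_shear:
  fixes F :: "heis \<Rightarrow> ennreal" and e :: real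
  assumes F: "F \<in> borel_measurable borel" and e: "\<bar>e\<bar> = 1"
  shows "(\<integral>\<^sup>+p. F (a + e * fst p, b + e * fst (snd p), c + \<alpha> * fst p + \<beta> * fst (snd p) + e * snd (snd p)) \<partial>lborel)
    = (\<integral>\<^sup>+p. F p \<partial>lborel)"
proof -
  have [measurable]: "F \<in> borel_measurable (borel \<Otimes>\<^sub>M borel \<Otimes>\<^sub>M borel)"
    using F by (simp add: borel_prod)
  have affine: "(\<integral>\<^sup>+t. G (s + e * t) \<partial>lborel) = (\<integral>\<^sup>+t. G t \<partial>lborel)"
    if "G \<in> borel_measurable borel" for s and G :: "real \<Rightarrow> ennreal"
    using nn_integral_real_affine[OF that, of e s] e by auto
  have "(\<integral>\<^sup>+p. F (a + e * fst p, b + e * fst (snd p), c + \<alpha> * fst p + \<beta> * fst (snd p) + e * snd (snd p)) \<partial>lborel)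
    = (\<integral>\<^sup>+x. \<integral>\<^sup>+y. \<integral>\<^sup>+t. F (a + e * x, b + e * y, (c + \<alpha> * x + \<beta> * y) + e * t) \<partial>lborel \<partial>lborel \<partial>lborel)"
    by (subst nn_integral_lborel_triple) (simp_all flip: borel_prod)
  also have "\<dots> = (\<integral>\<^sup>+x. \<integral>\<^sup>+y. \<integral>\<^sup>+t. F (a + e * x, b + e * y, t) \<partial>lborel \<partial>lborel \<partial>lborel)"
    by (rule nn_integral_cong, rule nn_integral_cong, rule affine) measurable
  also have "\<dots> = (\<integral>\<^sup>+x. \<integral>\<^sup>+y. \<integral>\<^sup>+t. F (a + e * x, y, t) \<partial>lborel \<partial>lborel \<partial>lborel)"
    by (rule nn_integral_cong, rule affine) measurable
  also have "\<dots> = (\<integral>\<^sup>+x. \<integral>\<^sup>+y. \<integral>\<^sup>+t. F (x, y, t) \<partial>lborel \<partial>lborel \<partial>lborel)"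
    by (rule affine) measurable
  also have "\<dots> = (\<integral>\<^sup>+p. F p \<partial>lborel)" by (rule nn_integral_lborel_triple[OF F, symmetric])
  finally show ?thesis .
qed

lemma nn_integral_heis_left:
  assumes "F \<in> borel_measurable borel"
  shows "(\<integral>\<^sup>+p. F (q \<odot> p) \<partial>lborel) = (\<integral>\<^sup>+p. F p \<partial>lborel)"
  using nn_integral_heis_shear[OF assms, of 1 "fst q" "fst (snd q)" "snd (snd q)" "- fst (snd q) / 2" "fst q / 2"]
  by (simp add: heis_mult_fst_snd diff_divide_distrib algebra_simps)

lemma nn_integral_heis_right:
  assumes "F \<in> borel_measurable borel"
  shows "(\<integral>\<^sup>+p. F (p \<odot> q) \<partial>lborel) = (\<integral>\<^sup>+p. F p \<partial>lborel)"
  using nn_integral_heis_shear[OF assms, of 1 "fst q" "fst (snd q)" "snd (snd q)" "fst (snd q) / 2" "- fst q / 2"]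
  by (simp add: heis_mult_fst_snd diff_divide_distrib algebra_simps)

lemma nn_integral_heis_left_inverse:
  assumes "F \<in> borel_measurable borel"
  shows "(\<integral>\<^sup>+w. F (p \<odot> - w) \<partial>lborel) = (\<integral>\<^sup>+p. F p \<partial>lborel)"
  using nn_integral_heis_shear[OF assms, of "-1" "fst p" "fst (snd p)" "snd (snd p)" "fst (snd p) / 2" "- fst p / 2"]
  by (simp add: heis_mult_fst_snd diff_divide_distrib algebra_simps)

text \<open>The group product differs from the sum only by a vertical term bilinear in q and p. Left
  translation by a small q therefore moves the points of a bounded set uniformly little.\<close>

lemma norm_heis_mult_diff_le: "norm (q \<odot> p - p) \<le> norm q * (1 + norm p)"
proof -
  have c: "\<bar>fst r\<bar> \<le> norm r" "\<bar>fst (snd r)\<bar> \<le> norm r" for r :: heis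
    using norm_fst_le[of "fst r" "snd r"] norm_snd_le[of "snd r" "fst r"] norm_fst_le[of "fst (snd r)" "snd (snd r)"]
    by auto
  define s where "s = (fst q * fst (snd p) - fst (snd q) * fst p) / 2"
  have "q \<odot> p - p = q + (0, 0, s)"
    by (simp add: heis_mult_fst_snd prod_eq_iff s_def)
  then have "norm (q \<odot> p - p) \<le> norm q + \<bar>s\<bar>"
    using norm_triangle_ineq[of q "(0, 0, s)"] by (simp add: norm_Pair)
  also have "\<bar>s\<bar> \<le> (\<bar>fst q\<bar> * \<bar>fst (snd p)\<bar> + \<bar>fst (snd q)\<bar> * \<bar>fst p\<bar>) / 2"
    unfolding s_def by (simp add: abs_mult[symmetric])
  also have "\<dots> \<le> (norm q * norm p + norm q * norm p) / 2"
    by (intro divide_right_mono add_mono mult_mono c) auto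
  finally show ?thesis by (simp add: algebra_simps)
qed

lemma compact_translate_subset_open:
  assumes "compact K" "open U" "K \<subseteq> U"
  obtains d where "d > 0" "\<And>q p. norm q < d \<Longrightarrow> p \<in> K \<Longrightarrow> q \<odot> p \<in> U"
proof -
  obtain e where e: "e > 0" "(\<Union>p\<in>K. ball p e) \<subseteq> U"
    using compact_subset_open_imp_ball_epsilon_subset[OF assms] by blast
  obtain R where R: "R > 0" "\<And>p. p \<in> K \<Longrightarrow> norm p \<le> R"
    using compact_imp_bounded[OF assms(1)] by (auto simp: bounded_pos)
  show ?thesis
  proof (rule that[of "e / (1 + R)"])
    show "e / (1 + R) > 0" using e R by simp
    fix q p :: heis assume q: "norm q < e / (1 + R)" and p: "p \<in> K"
    have "dist p (q \<odot> p) \<le> norm q * (1 + norm p)"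
      using norm_heis_mult_diff_le by (simp add: dist_norm norm_minus_commute)
    also have "\<dots> \<le> norm q * (1 + R)" using R(2)[OF p] by (intro mult_left_mono) auto
    also have "\<dots> < e" using q R(1) by (simp add: field_simps)
    finally show "q \<odot> p \<in> U" using e(2) p by (auto simp: subset_eq)
  qed
qed

section \<open>Approximation of sets and of integrable functions\<close>

lemma finite_measure_inner_compact:
  fixes A :: "'a::euclidean_space set"
  assumes A[measurable]: "A \<in> sets borel" and fin: "emeasure lborel A < \<infinity>" and e: "e > 0"
  obtains K where "compact K" "K \<subseteq> A" "emeasure lborel (A - K) \<le> ennreal e"
proof -
  \<comment> \<open>Inner regularity is applied to Lebesgue measure restricted to A, which is a
    finite measure.\<close>
  define M where "M = density lborel (indicator A)"
  have emM: "emeasure M B = emeasure lborel (A \<inter> B)" if "B \<in> sets borel" for B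
    using that by (simp add: M_def emeasure_density flip: indicator_inter_arith)
  have "emeasure M A = (SUP K\<in>{K. K \<subseteq> A \<and> compact K}. emeasure M K)"
    by (rule inner_regular) (use fin emM[of UNIV] in \<open>auto simp: M_def\<close>)
  also have "\<dots> = (SUP K\<in>{K. K \<subseteq> A \<and> compact K}. emeasure lborel (A \<inter> K))"
    by (intro SUP_cong refl emM) (auto simp: compact_imp_closed)
  finally have SUP: "emeasure lborel A = (SUP K\<in>{K. K \<subseteq> A \<and> compact K}. emeasure lborel (A \<inter> K))"
    using emM[OF A] by simp
  have "\<exists>K. K \<subseteq> A \<and> compact K \<and> emeasure lborel A \<le> emeasure lborel (A \<inter> K) + ennreal e"
  proof (rule ccontr)
    assume "\<not> ?thesis"
    then have le: "emeasure lborel (A \<inter> K) + ennreal e \<le> emeasure lborel A" if "K \<subseteq> A" "compact K" for K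
      using that by (auto simp: not_le intro: less_imp_le)
    have "(SUP K\<in>{K. K \<subseteq> A \<and> compact K}. emeasure lborel (A \<inter> K)) \<le> emeasure lborel A - ennreal e"
      by (rule SUP_least) (use le in \<open>auto simp: ennreal_le_minus_iff add.commute\<close>)
    moreover have "emeasure lborel A - ennreal e < emeasure lborel A"
      using le[of "{}"] fin e
      by (cases "emeasure lborel A") (auto simp: ennreal_minus intro!: ennreal_lessI)
    ultimately show False using SUP by simp
  qed
  then obtain K where K: "K \<subseteq> A" "compact K" "emeasure lborel A \<le> emeasure lborel K + ennreal e"
    by (metis inf.absorb2)
  have "emeasure lborel (A - K) = emeasure lborel A - emeasure lborel K"
    using K emeasure_compact_finite[OF K(2)] by (intro emeasure_Diff) (auto simp: compact_imp_closed)
  also have "\<dots> \<le> ennreal e" using K(3) fin by (auto simp: ennreal_minus_le_iff)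
  finally show ?thesis using that K by blast
qed

lemma finite_measure_outer_open:
  fixes A :: "'a::euclidean_space set"
  assumes A: "A \<in> sets borel" and e: "e > 0"
  obtains U where "open U" "A \<subseteq> U" "emeasure lborel (U - A) \<le> ennreal e"
proof -
  obtain U where U: "open U" "A \<subseteq> U" "emeasure lebesgue (U - A) < ennreal e"
    by (rule sets_lebesgue_outer_open[of A e]) (use A e in simp_all)
  then have "emeasure lborel (U - A) \<le> ennreal e"
    using A by simp
  then show ?thesis using that U by blast
qed

text \<open>Left translates are the relevant ones: the substitution q = p \<odot> - w turns
  \<open>mollify \<rho> f p\<close> into an average of f (- q \<odot> p).\<close>

definition translation_continuous :: "(heis \<Rightarrow> real) \<Rightarrow> bool" where
  "translation_continuous f \<longleftrightarrow> (\<forall>e>0. \<exists>d>0. \<forall>q. norm q < d \<longrightarrow>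
     (\<integral>\<^sup>+p. ennreal \<bar>f (q \<odot> p) - f p\<bar> \<partial>lborel) \<le> ennreal e)"

text \<open>A is enclosed between a compact K and an open U that differ little in measure, and small
  translates of K stay inside U.\<close>

lemma translation_continuous_indicator:
  assumes A[measurable]: "A \<in> sets borel" and fin: "emeasure lborel A < \<infinity>"
  shows "translation_continuous (indicator A)"
  unfolding translation_continuous_def
proof (intro allI impI)
  fix e :: real assume "e > 0"
  \<comment> \<open>The final comparison costs six times \<delta>: four from the two copies of U and
    one from each copy of A - K.\<close>
  define \<delta> where "\<delta> = e / 6"
  have \<delta>: "\<delta> > 0" using \<open>e > 0\<close> by (simp add: \<delta>_def)
  obtain K where K: "compact K" "K \<subseteq> A" "emeasure lborel (A - K) \<le> ennreal \<delta>"
    by (rule finite_measure_inner_compact[OF A fin \<delta>])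
  obtain U where U: "open U" "A \<subseteq> U" "emeasure lborel (U - A) \<le> ennreal \<delta>"
    by (rule finite_measure_outer_open[OF A \<delta>])
  have [measurable]: "K \<in> sets borel" "U \<in> sets borel"
    using K(1) U(1) by (auto simp: compact_imp_closed)
  obtain d where d: "d > 0" "\<And>q p. norm q < d \<Longrightarrow> p \<in> K \<Longrightarrow> q \<odot> p \<in> U"
    using compact_translate_subset_open[OF K(1) U(1)] K(2) U(2) by blast
  show "\<exists>d>0. \<forall>q. norm q < d \<longrightarrow>
     (\<integral>\<^sup>+p. ennreal \<bar>indicator A (q \<odot> p) - indicator A p\<bar> \<partial>lborel) \<le> ennreal e"
  proof (intro exI[of _ d] conjI d allI impI)
    fix q :: heis assume q: "norm q < d"
    have inU: "p \<in> U" if "q \<odot> p \<in> K" for p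
      using d(2)[of "- q" "q \<odot> p"] q that by simp
    let ?D = "\<lambda>p. ennreal \<bar>indicator A (q \<odot> p) - indicator A p\<bar>"
    have Kfin: "emeasure lborel K < \<infinity>" using K(1) by (rule emeasure_compact_finite)
    have "emeasure lborel U \<le> emeasure lborel K + emeasure lborel (A - K) + emeasure lborel (U - A)"
    proof -
      have "U = K \<union> (A - K) \<union> (U - A)" using K U by auto
      then have "emeasure lborel U = emeasure lborel (K \<union> (A - K) \<union> (U - A))" by simp
      also have "\<dots> = emeasure lborel (K \<union> (A - K)) + emeasure lborel (U - A)"
        using K(2) by (intro plus_emeasure[symmetric]) auto
      also have "emeasure lborel (K \<union> (A - K)) = emeasure lborel K + emeasure lborel (A - K)"
        by (intro plus_emeasure[symmetric]) auto
      finally show ?thesis by simp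
    qed
    also have "\<dots> \<le> emeasure lborel K + ennreal \<delta> + ennreal \<delta>"
      using K U by (intro add_mono) auto
    finally have Ule: "emeasure lborel U \<le> emeasure lborel K + ennreal \<delta> + ennreal \<delta>" .
    \<comment> \<open>The two indicators of K are added on the left, so that the finite measure of K
      is cancelled only at the end and no subtraction of extended reals is required.\<close>
    have "(\<integral>\<^sup>+p. ?D p + indicator K (q \<odot> p) + indicator K p \<partial>lborel)
      \<le> (\<integral>\<^sup>+p. 2 * indicator U p + indicator (A - K) (q \<odot> p) + indicator (A - K) p \<partial>lborel)"
      by (intro nn_integral_mono) (use inU K(2) U(2) in \<open>auto simp: indicator_def\<close>)
    also have "\<dots> = 2 * emeasure lborel U + emeasure lborel (A - K) + emeasure lborel (A - K)"
      using nn_integral_heis_left[of "indicator (A - K)" q] by (simp add: nn_integral_add nn_integral_cmult)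
    also have "\<dots> \<le> 2 * (emeasure lborel K + ennreal \<delta> + ennreal \<delta>) + ennreal \<delta> + ennreal \<delta>"
      using K Ule by (intro add_mono mult_left_mono) auto
    also have "(\<integral>\<^sup>+p. ?D p + indicator K (q \<odot> p) + indicator K p \<partial>lborel)
      = (\<integral>\<^sup>+p. ?D p \<partial>lborel) + emeasure lborel K + emeasure lborel K"
      using nn_integral_heis_left[of "indicator K" q] by (simp add: nn_integral_add)
    finally show "(\<integral>\<^sup>+p. ?D p \<partial>lborel) \<le> ennreal e"
      using Kfin \<delta> by (cases "emeasure lborel K"; cases "(\<integral>\<^sup>+p. ?D p \<partial>lborel)")
        (auto simp: \<delta>_def ennreal_mult'[symmetric] top_unique simp flip: ennreal_plus ennreal_numeral)
  qed
qed

lemma translation_continuousD: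
  assumes "translation_continuous f" "e > 0"
  obtains d where "d > 0" "\<And>q. norm q < d \<Longrightarrow> (\<integral>\<^sup>+p. ennreal \<bar>f (q \<odot> p) - f p\<bar> \<partial>lborel) \<le> ennreal e"
  using assms unfolding translation_continuous_def by meson

text \<open>Induction over multiples of indicators, sums and dominated limits. In a limit the error
  of the translated function equals that of the original one by left invariance.\<close>

lemma integrable_translation_continuous:
  assumes "integrable lborel f"
  shows "translation_continuous f"
  using assms
proof (induction rule: integrable_induct)
  case (base A c)
  show ?case
    unfolding translation_continuous_def
  proof (intro allI impI)
    fix e :: real assume e: "e > 0"
    have A[measurable]: "A \<in> sets borel" using base by simp
    \<comment> \<open>The added 1 covers c = 0.\<close>
    have "e / (\<bar>c\<bar> + 1) > 0" using e by (simp add: add_nonneg_pos)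
    from translation_continuousD[OF translation_continuous_indicator[OF A base(2)] this]
    obtain d where d: "d > 0" "\<And>q. norm q < d \<Longrightarrow>
        (\<integral>\<^sup>+p. ennreal \<bar>indicator A (q \<odot> p) - indicator A p\<bar> \<partial>lborel) \<le> ennreal (e / (\<bar>c\<bar> + 1))"
      by blast
    show "\<exists>d>0. \<forall>q. norm q < d \<longrightarrow>
        (\<integral>\<^sup>+p. ennreal \<bar>indicator A (q \<odot> p) *\<^sub>R c - indicator A p *\<^sub>R c\<bar> \<partial>lborel) \<le> ennreal e"
    proof (intro exI[of _ d] conjI d allI impI)
      fix q :: heis assume q: "norm q < d"
      have "(\<integral>\<^sup>+p. ennreal \<bar>indicator A (q \<odot> p) *\<^sub>R c - indicator A p *\<^sub>R c\<bar> \<partial>lborel)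
        = (\<integral>\<^sup>+p. ennreal \<bar>c\<bar> * ennreal \<bar>indicator A (q \<odot> p) - indicator A p\<bar> \<partial>lborel)"
        by (intro nn_integral_cong) (simp add: mult.commute[of _ c] flip: ennreal_mult abs_mult right_diff_distrib)
      also have "\<dots> = ennreal \<bar>c\<bar> * (\<integral>\<^sup>+p. ennreal \<bar>indicator A (q \<odot> p) - indicator A p\<bar> \<partial>lborel)"
        by (rule nn_integral_cmult) measurable
      also have "\<dots> \<le> ennreal \<bar>c\<bar> * ennreal (e / (\<bar>c\<bar> + 1))"
        using d(2)[OF q] by (rule mult_left_mono) simp
      also have "\<dots> \<le> ennreal e"
        using e by (simp add: divide_simps add_nonneg_pos flip: ennreal_mult)
      finally show "(\<integral>\<^sup>+p. ennreal \<bar>indicator A (q \<odot> p) *\<^sub>R c - indicator A p *\<^sub>R c\<bar> \<partial>lborel) \<le> ennreal e" .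
    qed
  qed
next
  case (add f g)
  have [measurable]: "f \<in> borel_measurable borel" "g \<in> borel_measurable borel"
    using add.hyps borel_measurable_integrable by auto
  show ?case
    unfolding translation_continuous_def
  proof (intro allI impI)
    fix e :: real assume e: "e > 0"
    obtain d1 where d1: "d1 > 0" "\<And>q. norm q < d1 \<Longrightarrow> (\<integral>\<^sup>+p. ennreal \<bar>f (q \<odot> p) - f p\<bar> \<partial>lborel) \<le> ennreal (e / 2)"
      using translation_continuousD[OF add.IH(1), of "e / 2"] e by auto
    obtain d2 where d2: "d2 > 0" "\<And>q. norm q < d2 \<Longrightarrow> (\<integral>\<^sup>+p. ennreal \<bar>g (q \<odot> p) - g p\<bar> \<partial>lborel) \<le> ennreal (e / 2)"
      using translation_continuousD[OF add.IH(2), of "e / 2"] e by auto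
    show "\<exists>d>0. \<forall>q. norm q < d \<longrightarrow>
        (\<integral>\<^sup>+p. ennreal \<bar>f (q \<odot> p) + g (q \<odot> p) - (f p + g p)\<bar> \<partial>lborel) \<le> ennreal e"
    proof (intro exI[of _ "min d1 d2"] conjI allI impI)
      fix q :: heis assume q: "norm q < min d1 d2"
      have "(\<integral>\<^sup>+p. ennreal \<bar>f (q \<odot> p) + g (q \<odot> p) - (f p + g p)\<bar> \<partial>lborel)
        \<le> (\<integral>\<^sup>+p. ennreal \<bar>f (q \<odot> p) - f p\<bar> + ennreal \<bar>g (q \<odot> p) - g p\<bar> \<partial>lborel)"
        by (intro nn_integral_mono) (auto simp flip: ennreal_plus intro!: ennreal_leI)
      also have "\<dots> = (\<integral>\<^sup>+p. ennreal \<bar>f (q \<odot> p) - f p\<bar> \<partial>lborel) + (\<integral>\<^sup>+p. ennreal \<bar>g (q \<odot> p) - g p\<bar> \<partial>lborel)"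
        by (rule nn_integral_add) measurable
      also have "\<dots> \<le> ennreal (e / 2) + ennreal (e / 2)"
        using q by (intro add_mono d1 d2) auto
      also have "\<dots> = ennreal e" using e by (simp flip: ennreal_plus)
      finally show "(\<integral>\<^sup>+p. ennreal \<bar>f (q \<odot> p) + g (q \<odot> p) - (f p + g p)\<bar> \<partial>lborel) \<le> ennreal e" .
    qed (use d1 d2 in auto)
  qed
next
  case (lim f s)
  have [measurable]: "f \<in> borel_measurable borel" "s i \<in> borel_measurable borel" for i
    using lim.hyps borel_measurable_integrable by auto
  show ?case
    unfolding translation_continuous_def
  proof (intro allI impI)
    fix e :: real assume e: "e > 0"
    have "(\<lambda>i. \<integral>\<^sup>+p. ennreal (norm (f p - s i p)) \<partial>lborel) \<longlonglongrightarrow> 0"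
    proof (rule nn_integral_dominated_convergence_norm[where w = "\<lambda>p. 2 * norm (f p)"])
      show "(\<integral>\<^sup>+p. ennreal (2 * norm (f p)) \<partial>lborel) < \<infinity>"
        using integrable_mult_right[OF integrable_norm[OF lim.hyps(4)], of 2]
        unfolding integrable_iff_bounded by simp
    qed (use lim.hyps in \<open>auto intro: AE_I2\<close>)
    then have "\<forall>\<^sub>F i in sequentially. (\<integral>\<^sup>+p. ennreal (norm (f p - s i p)) \<partial>lborel) < ennreal (e / 3)"
      using e by (intro order_tendstoD(2)) auto
    then obtain i where i: "(\<integral>\<^sup>+p. ennreal \<bar>f p - s i p\<bar> \<partial>lborel) \<le> ennreal (e / 3)"
      using eventually_happens[of _ "sequentially"] by (auto intro: less_imp_le)
    obtain d where d: "d > 0" "\<And>q. norm q < d \<Longrightarrow> (\<integral>\<^sup>+p. ennreal \<bar>s i (q \<odot> p) - s i p\<bar> \<partial>lborel) \<le> ennreal (e / 3)"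
      using translation_continuousD[OF lim.IH, of "e / 3"] e by auto
    show "\<exists>d>0. \<forall>q. norm q < d \<longrightarrow>
        (\<integral>\<^sup>+p. ennreal \<bar>f (q \<odot> p) - f p\<bar> \<partial>lborel) \<le> ennreal e"
    proof (intro exI[of _ d] conjI d allI impI)
      fix q :: heis assume q: "norm q < d"
      have "(\<integral>\<^sup>+p. ennreal \<bar>f (q \<odot> p) - f p\<bar> \<partial>lborel)
        \<le> (\<integral>\<^sup>+p. ennreal \<bar>f (q \<odot> p) - s i (q \<odot> p)\<bar> + ennreal \<bar>s i (q \<odot> p) - s i p\<bar> + ennreal \<bar>f p - s i p\<bar> \<partial>lborel)"
        by (intro nn_integral_mono) (auto simp flip: ennreal_plus intro!: ennreal_leI)
      also have "\<dots> = (\<integral>\<^sup>+p. ennreal \<bar>f (q \<odot> p) - s i (q \<odot> p)\<bar> \<partial>lborel)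
         + (\<integral>\<^sup>+p. ennreal \<bar>s i (q \<odot> p) - s i p\<bar> \<partial>lborel) + (\<integral>\<^sup>+p. ennreal \<bar>f p - s i p\<bar> \<partial>lborel)"
        by (simp add: nn_integral_add)
      also have "(\<integral>\<^sup>+p. ennreal \<bar>f (q \<odot> p) - s i (q \<odot> p)\<bar> \<partial>lborel) = (\<integral>\<^sup>+p. ennreal \<bar>f p - s i p\<bar> \<partial>lborel)"
        by (rule nn_integral_heis_left) measurable
      also have "(\<integral>\<^sup>+p. ennreal \<bar>f p - s i p\<bar> \<partial>lborel)
         + (\<integral>\<^sup>+p. ennreal \<bar>s i (q \<odot> p) - s i p\<bar> \<partial>lborel) + (\<integral>\<^sup>+p. ennreal \<bar>f p - s i p\<bar> \<partial>lborel)
         \<le> ennreal (e / 3) + ennreal (e / 3) + ennreal (e / 3)"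
        by (intro add_mono d(2) i q)
      also have "\<dots> = ennreal e" using e by (simp flip: ennreal_plus)
      finally show "(\<integral>\<^sup>+p. ennreal \<bar>f (q \<odot> p) - f p\<bar> \<partial>lborel) \<le> ennreal e" .
    qed
  qed
qed

subsection \<open>Mollification\<close>

lemma partial_bounded_support:
  fixes \<phi> :: "'a::euclidean_space \<Rightarrow> real"
  assumes C: "C_k (Suc 0) \<phi>" and R: "\<And>p. \<phi> p \<noteq> 0 \<Longrightarrow> norm p \<le> R"
    and "frechet_derivative \<phi> (at p) v \<noteq> 0"
  shows "norm p \<le> R"
proof (rule ccontr)
  assume "\<not> norm p \<le> R"
  then have "p \<in> - cball 0 R" by simp
  moreover have "open (- cball (0 :: 'a) R)" by (rule open_Compl[OF closed_cball])
  ultimately have "(\<phi> has_derivative (\<lambda>_. 0)) (at p)"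
    using R by (intro has_derivative_transform_within_open[OF has_derivative_const[of 0]]) force+
  then have "frechet_derivative \<phi> (at p) = (\<lambda>_. 0)"
    by (metis frechet_derivative_at)
  then show False using assms(3) by simp
qed

text \<open>The group law is affine in its second factor, so translated kernels are compositions
  with affine maps and remain test functions.\<close>

lemma bounded_linear_heis_mult_left: "bounded_linear (\<lambda>w. p \<odot> w - p)"
  unfolding heis_mult_fst_snd
  by (rule linear_conv_bounded_linear[THEN iffD1], rule linearI)
    (simp_all add: prod_eq_iff algebra_simps add_divide_distrib diff_divide_distrib)

text \<open>Since w = - (p \<odot> - w) \<odot> p, the point w is a left translate of p by an
  element of norm at most R.\<close>

lemma norm_le_of_support:
  assumes "norm (p \<odot> - w) \<le> R"
  shows "norm w \<le> norm p + R * (1 + norm p)"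
proof -
  have w: "w = - (p \<odot> - w) \<odot> p"
    by (simp add: heis_mult_minus heis_mult_assoc) (simp add: heis_mult_fst_snd)
  have "norm w \<le> norm p + norm (w - p)" by (metis add.commute diff_add_cancel norm_triangle_ineq)
  also have "norm (w - p) \<le> norm (- (p \<odot> - w)) * (1 + norm p)"
    by (subst w) (rule norm_heis_mult_diff_le)
  also have "\<dots> \<le> R * (1 + norm p)" using assms by (intro mult_right_mono) auto
  finally show ?thesis by simp
qed

lemma test_function_translate:
  assumes "test_function \<rho>"
  shows "test_function (\<lambda>w. \<rho> (p \<odot> - w))"
proof -
  have L: "bounded_linear (\<lambda>w. p \<odot> - w - p)"
    using bounded_linear_compose[OF bounded_linear_heis_mult_left bounded_linear_minus[OF bounded_linear_ident]]
    by simp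
  have "C_k k (\<lambda>w. \<rho> (p + (p \<odot> - w - p)))" for k
    by (rule C_k_affine[OF L]) (use assms in \<open>simp add: test_function_def\<close>)
  then have C: "C_k k (\<lambda>w. \<rho> (p \<odot> - w))" for k by simp
  obtain R where "\<And>q. \<rho> q \<noteq> 0 \<Longrightarrow> norm q \<le> R"
    using test_function_bounded_support[OF assms] by blast
  then show ?thesis
    by (intro test_functionI[OF C, of "norm p + R * (1 + norm p)"] norm_le_of_support)
qed

text \<open>This is the derivative along the left-invariant field a X + b Y; the common form lets
  one argument treat both fields.\<close>

definition horizontal_derivative :: "real \<Rightarrow> real \<Rightarrow> (heis \<Rightarrow> real) \<Rightarrow> heis \<Rightarrow> real" where
  "horizontal_derivative a b \<phi> w =
     frechet_derivative \<phi> (at w) (a, b, (fst w * b - fst (snd w) * a) / 2)"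

text \<open>The group convolution of \<rho> and f with \<rho> on the left. It averages left
  translates of f, and these commute with X and Y.\<close>

definition mollify :: "(heis \<Rightarrow> real) \<Rightarrow> (heis \<Rightarrow> real) \<Rightarrow> heis \<Rightarrow> real" where
  "mollify \<rho> f p = (\<integral>w. f w * \<rho> (p \<odot> - w) \<partial>lborel)"

section \<open>Continuity and L^1 bounds for the mollified function\<close>

locale mollification =
  fixes f \<rho> :: "heis \<Rightarrow> real"
  assumes f: "integrable lborel f" and \<rho>: "test_function \<rho>" and \<rho>_nonneg: "\<And>q. \<rho> q \<ge> 0"
    and \<rho>_mass: "(\<integral>\<^sup>+q. ennreal (\<rho> q) \<partial>lborel) = 1"
begin

lemma \<rho>_continuous: "continuous_on UNIV \<rho>"
  by (rule test_function_continuous[OF \<rho>])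

lemma \<rho>_measurable [measurable]: "\<rho> \<in> borel_measurable borel"
  by (rule borel_measurable_continuous_onI[OF \<rho>_continuous])

lemma f_measurable [measurable]: "f \<in> borel_measurable borel"
  using borel_measurable_integrable[OF f] by simp

lemma \<rho>_bounded: obtains M where "M > 0" "\<And>q. \<bar>\<rho> q\<bar> \<le> M"
proof -
  obtain R where R: "\<And>q. \<rho> q \<noteq> 0 \<Longrightarrow> norm q \<le> R"
    by (rule test_function_bounded_support[OF \<rho>]) blast
  show ?thesis
    by (rule continuous_bounded_support_bounded[OF \<rho>_continuous R]) (assumption, rule that)
qed

lemma kernel_bounded: obtains M where "\<And>p w. norm (f w * \<rho> (p \<odot> - w)) \<le> M * \<bar>f w\<bar>"
proof -
  obtain M where M: "M > 0" "\<And>q. \<bar>\<rho> q\<bar> \<le> M" by (rule \<rho>_bounded) blast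
  have "norm (f w * \<rho> (p \<odot> - w)) \<le> M * \<bar>f w\<bar>" for p w
    using mult_right_mono[OF M(2)[of "p \<odot> - w"], of "\<bar>f w\<bar>"] by (simp add: abs_mult mult.commute)
  then show ?thesis by (rule that)
qed

lemma integrable_kernel: "integrable lborel (\<lambda>w. f w * \<rho> (p \<odot> - w))"
proof -
  obtain M where M: "\<And>p w. norm (f w * \<rho> (p \<odot> - w)) \<le> M * \<bar>f w\<bar>" by (rule kernel_bounded) blast
  have "norm (f w * \<rho> (p \<odot> - w)) \<le> norm (M * \<bar>f w\<bar>)" for w
    using order_trans[OF M abs_ge_self] by simp
  then show ?thesis
    by (intro Bochner_Integration.integrable_bound[OF integrable_mult_right[OF integrable_abs[OF f], of M]] AE_I2) simp_all
qed

lemma mollify_continuous: "continuous_on UNIV (mollify \<rho> f)"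
  unfolding continuous_on_sequentially comp_def mollify_def
proof (intro allI ballI impI)
  fix P :: "nat \<Rightarrow> heis" and p assume "(\<forall>n. P n \<in> UNIV) \<and> P \<longlonglongrightarrow> p"
  then have P: "P \<longlonglongrightarrow> p" by blast
  obtain M where M: "\<And>p w. norm (f w * \<rho> (p \<odot> - w)) \<le> M * \<bar>f w\<bar>" by (rule kernel_bounded) blast
  show "(\<lambda>n. \<integral>w. f w * \<rho> (P n \<odot> - w) \<partial>lborel) \<longlonglongrightarrow> (\<integral>w. f w * \<rho> (p \<odot> - w) \<partial>lborel)"
  proof (rule integral_dominated_convergence[where w = "\<lambda>w. M * \<bar>f w\<bar>"])
    show "AE w in lborel. (\<lambda>n. f w * \<rho> (P n \<odot> - w)) \<longlonglongrightarrow> f w * \<rho> (p \<odot> - w)"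
    proof (rule AE_I2, rule tendsto_mult[OF tendsto_const])
      fix w
      have "continuous_on UNIV (\<lambda>q. \<rho> (q \<odot> - w))"
        by (intro continuous_on_compose2[OF \<rho>_continuous] continuous_intros) auto
      from continuous_on_tendsto_compose[OF this P] show "(\<lambda>n. \<rho> (P n \<odot> - w)) \<longlonglongrightarrow> \<rho> (p \<odot> - w)"
        by simp
    qed
    show "AE w in lborel. norm (f w * \<rho> (P n \<odot> - w)) \<le> M * \<bar>f w\<bar>" for n
      by (rule AE_I2) (rule M)
  qed (use f in simp_all)
qed

lemma mollify_measurable [measurable]: "mollify \<rho> f \<in> borel_measurable borel"
  by (rule borel_measurable_continuous_onI[OF mollify_continuous])

lemma kernel_mass: "(\<integral>\<^sup>+p. ennreal (\<rho> (p \<odot> - w)) \<partial>lborel) = 1" "(\<integral>\<^sup>+w. ennreal (\<rho> (p \<odot> - w)) \<partial>lborel) = 1"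
  using nn_integral_heis_right[of "\<lambda>q. ennreal (\<rho> q)" "- w"] \<rho>_mass
    nn_integral_heis_left_inverse[of "\<lambda>q. ennreal (\<rho> q)" p] by simp_all

lemma mollify_L1: "(\<integral>\<^sup>+p. ennreal \<bar>mollify \<rho> f p\<bar> \<partial>lborel) \<noteq> \<infinity>"
proof -
  have "(\<integral>\<^sup>+p. ennreal \<bar>mollify \<rho> f p\<bar> \<partial>lborel) \<le> (\<integral>\<^sup>+p. \<integral>\<^sup>+w. ennreal \<bar>f w\<bar> * ennreal (\<rho> (p \<odot> - w)) \<partial>lborel \<partial>lborel)"
    unfolding mollify_def
    using integral_norm_bound_ennreal[OF integrable_kernel] \<rho>_nonneg
    by (intro nn_integral_mono) (simp add: abs_mult ennreal_mult)
  also have "\<dots> = (\<integral>\<^sup>+w. \<integral>\<^sup>+p. ennreal \<bar>f w\<bar> * ennreal (\<rho> (p \<odot> - w)) \<partial>lborel \<partial>lborel)"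
    by (rule lborel_pair.Fubini') measurable
  also have "\<dots> = (\<integral>\<^sup>+w. ennreal \<bar>f w\<bar> \<partial>lborel)"
    by (simp add: nn_integral_cmult kernel_mass)
  also have "\<dots> < \<infinity>" using f by (simp add: integrable_iff_bounded)
  finally show ?thesis by simp
qed

text \<open>The error is an average, with weight \<rho> of mass 1, of differences between left
  translates of f and f itself. Exchanging the integrals bounds its L^1 norm by the largest
  translation error over the points where \<rho> is nonzero.\<close>

lemma mollify_approx:
  assumes supp: "\<And>q. \<rho> q \<noteq> 0 \<Longrightarrow> (\<integral>\<^sup>+p. ennreal \<bar>f (- q \<odot> p) - f p\<bar> \<partial>lborel) \<le> ennreal \<epsilon>"
  shows "(\<integral>\<^sup>+p. ennreal \<bar>mollify \<rho> f p - f p\<bar> \<partial>lborel) \<le> ennreal \<epsilon>"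
proof -
  have diff: "ennreal \<bar>mollify \<rho> f p - f p\<bar> \<le> (\<integral>\<^sup>+q. ennreal \<bar>f (- q \<odot> p) - f p\<bar> * ennreal (\<rho> q) \<partial>lborel)" for p
  proof -
    have int: "integrable lborel (\<lambda>w. \<rho> (p \<odot> - w))"
      using \<rho>_nonneg kernel_mass by (intro integrableI_nonneg) auto
    moreover have "(\<integral>w. \<rho> (p \<odot> - w) \<partial>lborel) = 1"
      using \<rho>_nonneg kernel_mass by (subst integral_eq_nn_integral) auto
    ultimately have "mollify \<rho> f p - f p = (\<integral>w. f w * \<rho> (p \<odot> - w) - f p * \<rho> (p \<odot> - w) \<partial>lborel)"
      unfolding mollify_def by (subst Bochner_Integration.integral_diff[OF integrable_kernel]) auto
    also have "ennreal \<bar>\<dots>\<bar> \<le> (\<integral>\<^sup>+w. ennreal \<bar>f w * \<rho> (p \<odot> - w) - f p * \<rho> (p \<odot> - w)\<bar> \<partial>lborel)"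
      using integral_norm_bound_ennreal[OF Bochner_Integration.integrable_diff[OF integrable_kernel integrable_mult_right[OF int]]]
      by simp
    \<comment> \<open>Writing w as - (p \<odot> - w) \<odot> p makes the integrand a function of p
      \<odot> - w, as the substitution requires.\<close>
    also have "\<dots> = (\<integral>\<^sup>+w. ennreal \<bar>f (- (p \<odot> - w) \<odot> p) - f p\<bar> * ennreal (\<rho> (p \<odot> - w)) \<partial>lborel)"
    proof (rule nn_integral_cong)
      fix w
      have "- (p \<odot> - w) \<odot> p = w"
        by (simp add: heis_mult_minus heis_mult_assoc) (simp add: heis_mult_fst_snd)
      then show "ennreal \<bar>f w * \<rho> (p \<odot> - w) - f p * \<rho> (p \<odot> - w)\<bar>
        = ennreal \<bar>f (- (p \<odot> - w) \<odot> p) - f p\<bar> * ennreal (\<rho> (p \<odot> - w))"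
        using \<rho>_nonneg by (simp add: abs_mult flip: left_diff_distrib ennreal_mult)
    qed
    also have "\<dots> = (\<integral>\<^sup>+q. ennreal \<bar>f (- q \<odot> p) - f p\<bar> * ennreal (\<rho> q) \<partial>lborel)"
      by (rule nn_integral_heis_left_inverse) measurable
    finally show ?thesis .
  qed
  have "(\<integral>\<^sup>+p. ennreal \<bar>mollify \<rho> f p - f p\<bar> \<partial>lborel)
    \<le> (\<integral>\<^sup>+p. \<integral>\<^sup>+q. ennreal \<bar>f (- q \<odot> p) - f p\<bar> * ennreal (\<rho> q) \<partial>lborel \<partial>lborel)"
    by (intro nn_integral_mono diff)
  also have "\<dots> = (\<integral>\<^sup>+q. \<integral>\<^sup>+p. ennreal \<bar>f (- q \<odot> p) - f p\<bar> * ennreal (\<rho> q) \<partial>lborel \<partial>lborel)"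
    by (rule lborel_pair.Fubini') measurable
  also have "\<dots> = (\<integral>\<^sup>+q. (\<integral>\<^sup>+p. ennreal \<bar>f (- q \<odot> p) - f p\<bar> \<partial>lborel) * ennreal (\<rho> q) \<partial>lborel)"
    by (intro nn_integral_cong nn_integral_multc) measurable
  also have "\<dots> \<le> (\<integral>\<^sup>+q. ennreal \<epsilon> * ennreal (\<rho> q) \<partial>lborel)"
  proof (intro nn_integral_mono)
    fix q show "(\<integral>\<^sup>+p. ennreal \<bar>f (- q \<odot> p) - f p\<bar> \<partial>lborel) * ennreal (\<rho> q) \<le> ennreal \<epsilon> * ennreal (\<rho> q)"
      using supp[of q] by (cases "\<rho> q = 0") (auto intro: mult_right_mono)
  qed
  also have "\<dots> = ennreal \<epsilon>" by (simp add: nn_integral_cmult \<rho>_mass)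
  finally show ?thesis .
qed

end

section \<open>Upper gradients of the mollified function\<close>

locale mollified_derivative = mollification +
  fixes a b :: real and M1 M2 :: "heis measure"
  assumes M1: "finite_measure M1" "sets M1 = sets borel" and M2: "finite_measure M2" "sets M2 = sets borel"
    and weak: "\<And>\<phi>. test_function \<phi> \<Longrightarrow>
      (\<integral>w. f w * horizontal_derivative a b \<phi> w \<partial>lborel) = - ((\<integral>w. \<phi> w \<partial>M1) - (\<integral>w. \<phi> w \<partial>M2))"
begin

interpretation M1: finite_measure M1 by (rule M1)
interpretation M2: finite_measure M2 by (rule M2)

declare M1(2) [measurable_cong] M2(2) [measurable_cong]

text \<open>The density obtained by mollifying M1 + M2. It dominates the derivative of the mollified
  function along a X + b Y without increasing the total mass.\<close>

definition G :: "heis \<Rightarrow> ennreal" where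
  "G p = (\<integral>\<^sup>+w. ennreal (\<rho> (p \<odot> - w)) \<partial>M1) + (\<integral>\<^sup>+w. ennreal (\<rho> (p \<odot> - w)) \<partial>M2)"

lemma G_measurable [measurable]: "G \<in> borel_measurable borel"
  unfolding G_def by measurable

lemma G_mass: "(\<integral>\<^sup>+p. G p \<partial>lborel) = emeasure M1 UNIV + emeasure M2 UNIV"
proof -
  have *: "(\<integral>\<^sup>+p. \<integral>\<^sup>+w. ennreal (\<rho> (p \<odot> - w)) \<partial>M \<partial>lborel) = emeasure M UNIV"
    if "finite_measure M" and sets[measurable_cong]: "sets M = sets borel" for M
  proof -
    interpret M: finite_measure M by fact
    interpret pair_sigma_finite lborel M ..
    have "(\<integral>\<^sup>+p. \<integral>\<^sup>+w. ennreal (\<rho> (p \<odot> - w)) \<partial>M \<partial>lborel) = (\<integral>\<^sup>+w. \<integral>\<^sup>+p. ennreal (\<rho> (p \<odot> - w)) \<partial>lborel \<partial>M)"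
      by (rule Fubini'[symmetric]) measurable
    also have "\<dots> = emeasure M UNIV"
      using sets_eq_imp_space_eq[OF sets] by (simp add: kernel_mass)
    finally show ?thesis .
  qed
  have "(\<integral>\<^sup>+p. G p \<partial>lborel) = (\<integral>\<^sup>+p. \<integral>\<^sup>+w. ennreal (\<rho> (p \<odot> - w)) \<partial>M1 \<partial>lborel)
      + (\<integral>\<^sup>+p. \<integral>\<^sup>+w. ennreal (\<rho> (p \<odot> - w)) \<partial>M2 \<partial>lborel)"
    unfolding G_def by (rule nn_integral_add) measurable
  then show ?thesis by (simp add: * M1 M2)
qed

text \<open>The curve \<gamma> is the integral line of a X + b Y through p. For each w the increment
  of the kernel along \<gamma> is the integral of \<psi>; after exchanging integrals, \<psi> is up
  to sign the horizontal derivative in w of a translated kernel, so the weak derivative of f can be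
  inserted.\<close>

lemma mollify_upper_gradient:
  assumes r: "r1 \<le> r2"
  shows "ennreal \<bar>mollify \<rho> f (p \<odot> (r2 * a, r2 * b, 0)) - mollify \<rho> f (p \<odot> (r1 * a, r1 * b, 0))\<bar>
    \<le> (\<integral>\<^sup>+r. G (p \<odot> (r * a, r * b, 0)) * indicator {r1..r2} r \<partial>lborel)"
proof -
  define \<gamma> where "\<gamma> = (\<lambda>r. p \<odot> (r * a, r * b, 0))"
  \<comment> \<open>The vertical component of the r-derivative of \<gamma> r \<odot> - w, which does
    not depend on r.\<close>
  define c where "c = (\<lambda>w :: heis. ((fst p + fst w) * b - (fst (snd p) + fst (snd w)) * a) / 2)"
  let ?D = "\<lambda>z. frechet_derivative \<rho> (at z)"
  define \<psi> where "\<psi> = (\<lambda>r w. ?D (\<gamma> r \<odot> - w) (a, b, c w))"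
  have C1: "C_k (Suc 0) \<rho>" using \<rho> unfolding test_function_def by blast
  note D = C_k_has_derivative[OF C1]
  have \<gamma>_cont: "continuous_on UNIV \<gamma>" unfolding \<gamma>_def by (intro continuous_intros)
  have \<psi>_cont: "continuous_on UNIV (\<lambda>z. \<psi> (fst z) (snd z))"
    unfolding \<psi>_def c_def
    by (intro continuous_on_C_k_derivative[OF C1] continuous_intros continuous_on_compose2[OF \<gamma>_cont]) simp_all
  have \<rho>_deriv: "((\<lambda>r. \<rho> (\<gamma> r \<odot> - w)) has_real_derivative \<psi> r w) (at r)" for r w
  proof -
    have "((\<lambda>r. \<gamma> r \<odot> - w) has_derivative (\<lambda>h. h *\<^sub>R (a, b, c w))) (at r)"
      unfolding \<gamma>_def heis_mult_fst_snd c_def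
      by (auto intro!: derivative_eq_intros simp: field_simps)
    from has_derivative_compose[OF this D]
    have "((\<lambda>r. \<rho> (\<gamma> r \<odot> - w)) has_derivative (\<lambda>h. ?D (\<gamma> r \<odot> - w) (h *\<^sub>R (a, b, c w)))) (at r)" .
    moreover have "?D z (h *\<^sub>R v) = h * ?D z v" for z h v
      using linear_scale[OF C_k_derivative_linear[OF C1]] by simp
    then have "?D (\<gamma> r \<odot> - w) (h *\<^sub>R (a, b, c w)) = \<psi> r w * h" for h
      by (simp only: \<psi>_def mult.commute[of h])
    ultimately show ?thesis
      unfolding has_field_derivative_def by (simp only:)
  qed
  \<comment> \<open>Moving w along the field by h changes \<gamma> r \<odot> - w exactly as moving r
    by -h, which explains the sign. Left invariance is used here.\<close>
  have H: "horizontal_derivative a b (\<lambda>w. \<rho> (\<gamma> r \<odot> - w)) w = - \<psi> r w" for r w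
  proof -
    let ?v = "(a, b, (fst w * b - fst (snd w) * a) / 2)"
    have "((\<lambda>w. \<gamma> r \<odot> - w) has_derivative (\<lambda>h. \<gamma> r \<odot> - h - \<gamma> r)) (at w)"
    proof -
      have "bounded_linear (\<lambda>h. \<gamma> r \<odot> - h - \<gamma> r)"
        using bounded_linear_compose[OF bounded_linear_heis_mult_left bounded_linear_minus[OF bounded_linear_ident]]
        by simp
      from has_derivative_add[OF bounded_linear_imp_has_derivative[OF this] has_derivative_const[of "\<gamma> r"]]
      show ?thesis by simp
    qed
    from has_derivative_compose[OF this D]
    have "((\<lambda>w. \<rho> (\<gamma> r \<odot> - w)) has_derivative (\<lambda>h. ?D (\<gamma> r \<odot> - w) (\<gamma> r \<odot> - h - \<gamma> r))) (at w)" .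
    then have "frechet_derivative (\<lambda>w. \<rho> (\<gamma> r \<odot> - w)) (at w) = (\<lambda>h. ?D (\<gamma> r \<odot> - w) (\<gamma> r \<odot> - h - \<gamma> r))"
      by (rule frechet_derivative_at[symmetric])
    moreover have "\<gamma> r \<odot> - ?v - \<gamma> r = - (a, b, c w)"
      by (simp add: \<gamma>_def heis_mult_fst_snd c_def field_simps)
    moreover have "?D z (- v) = - ?D z v" for z v
      using linear_neg[OF C_k_derivative_linear[OF C1]] by simp
    ultimately show ?thesis by (simp only: horizontal_derivative_def \<psi>_def)
  qed
  obtain R where R: "R > 0" "\<And>q. \<rho> q \<noteq> 0 \<Longrightarrow> norm q \<le> R"
    by (rule test_function_bounded_support[OF \<rho>]) blast
  have "compact (\<gamma> ` {r1..r2})"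
    by (intro compact_continuous_image continuous_on_subset[OF \<gamma>_cont]) auto
  from compact_imp_bounded[OF this]
  obtain P where P: "P > 0" "\<And>r. r \<in> {r1..r2} \<Longrightarrow> norm (\<gamma> r) \<le> P"
    unfolding bounded_pos by blast
  \<comment> \<open>A radius for w outside which \<psi> r vanishes for all r in the interval. The
    bound on the compact set is thereby valid for every w.\<close>
  define S where "S = P + R * (1 + P)"
  have "compact ((\<lambda>z. \<psi> (fst z) (snd z)) ` ({r1..r2} \<times> cball 0 S))"
    by (intro compact_continuous_image continuous_on_subset[OF \<psi>_cont] compact_Times) auto
  from compact_imp_bounded[OF this] obtain B where B0: "B > 0"
      "\<And>z. z \<in> {r1..r2} \<times> cball 0 S \<Longrightarrow> norm (\<psi> (fst z) (snd z)) \<le> B"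
    unfolding bounded_pos by blast
  have B: "B > 0" "\<And>r w. r \<in> {r1..r2} \<Longrightarrow> norm w \<le> S \<Longrightarrow> \<bar>\<psi> r w\<bar> \<le> B"
  proof -
    show "\<bar>\<psi> r w\<bar> \<le> B" if "r \<in> {r1..r2}" "norm w \<le> S" for r w
      using B0(2)[of "(r, w)"] that by simp
  qed (rule B0)
  have \<psi>B: "\<bar>\<psi> r w\<bar> \<le> B" if "r \<in> {r1..r2}" for r w
  proof (cases "\<psi> r w = 0")
    case False
    have "norm (\<gamma> r \<odot> - w) \<le> R"
      by (rule partial_bounded_support[OF C1 _ False[unfolded \<psi>_def]]) (rule R(2))
    then have "norm w \<le> norm (\<gamma> r) + R * (1 + norm (\<gamma> r))" by (rule norm_le_of_support)
    also have "\<dots> \<le> S" unfolding S_def using P(2)[OF that] R(1) by (intro add_mono mult_left_mono) auto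
    finally show ?thesis by (rule B(2)[OF that])
  qed (use B in simp)
  have "(\<lambda>z. \<psi> (fst z) (snd z)) \<in> borel_measurable borel"
    by (rule borel_measurable_continuous_onI[OF \<psi>_cont])
  then have [measurable]: "(\<lambda>z. \<psi> (fst z) (snd z)) \<in> borel_measurable (borel \<Otimes>\<^sub>M borel)"
    by (simp add: borel_prod)
  have \<gamma>_meas[measurable]: "\<gamma> \<in> borel_measurable borel"
    by (rule borel_measurable_continuous_onI[OF \<gamma>_cont])
  let ?F = "\<lambda>w r. f w * (indicator {r1..r2} r * \<psi> r w)"
  have F_meas: "case_prod ?F \<in> borel_measurable (lborel \<Otimes>\<^sub>M lborel)"
  proof -
    have "(\<lambda>z. f (fst z) * (indicator {r1..r2} (snd z) * (\<lambda>z. \<psi> (fst z) (snd z)) (snd z, fst z)))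
        \<in> borel_measurable (lborel \<Otimes>\<^sub>M lborel)"
      by measurable
    then show ?thesis by (simp add: case_prod_beta)
  qed
  \<comment> \<open>The dominating function is B \<bar>f w\<bar> times the indicator of the
    interval; this justifies the exchange of signed integrals.\<close>
  have F_int: "integrable (lborel \<Otimes>\<^sub>M lborel) (case_prod ?F)"
  proof (rule integrableI_bounded[OF F_meas])
    have "(\<integral>\<^sup>+z. ennreal (norm (case_prod ?F z)) \<partial>(lborel \<Otimes>\<^sub>M lborel))
      = (\<integral>\<^sup>+w. \<integral>\<^sup>+r. ennreal (norm (?F w r)) \<partial>lborel \<partial>lborel)"
      using F_meas by (subst lborel.nn_integral_fst[symmetric]) auto
    also have "\<dots> \<le> (\<integral>\<^sup>+w. \<integral>\<^sup>+r. ennreal (B * \<bar>f w\<bar>) * indicator {r1..r2} r \<partial>lborel \<partial>lborel)"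
      by (intro nn_integral_mono)
        (auto simp: indicator_def abs_mult mult.commute[of "\<bar>f _\<bar>"] intro!: ennreal_leI mult_right_mono \<psi>B)
    also have "\<dots> = (\<integral>\<^sup>+w. ennreal (B * (r2 - r1)) * ennreal \<bar>f w\<bar> \<partial>lborel)"
    proof (rule nn_integral_cong)
      fix w
      have "(\<integral>\<^sup>+r. ennreal (B * \<bar>f w\<bar>) * indicator {r1..r2} r \<partial>lborel) = ennreal (B * \<bar>f w\<bar>) * ennreal (r2 - r1)"
        using r by (subst nn_integral_cmult_indicator) auto
      also have "\<dots> = ennreal (B * (r2 - r1)) * ennreal \<bar>f w\<bar>"
        using r B(1) by (simp add: mult_ac flip: ennreal_mult)
      finally show "(\<integral>\<^sup>+r. ennreal (B * \<bar>f w\<bar>) * indicator {r1..r2} r \<partial>lborel)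
        = ennreal (B * (r2 - r1)) * ennreal \<bar>f w\<bar>" .
    qed
    also have "\<dots> = ennreal (B * (r2 - r1)) * (\<integral>\<^sup>+w. ennreal \<bar>f w\<bar> \<partial>lborel)"
      by (rule nn_integral_cmult) measurable
    also have "\<dots> < \<infinity>"
      using f by (simp add: integrable_iff_bounded ennreal_mult_less_top)
    finally show "(\<integral>\<^sup>+z. ennreal (norm (case_prod ?F z)) \<partial>(lborel \<Otimes>\<^sub>M lborel)) < \<infinity>" .
  qed
  have FTC: "(\<integral>r. ?F w r \<partial>lborel) = f w * \<rho> (\<gamma> r2 \<odot> - w) - f w * \<rho> (\<gamma> r1 \<odot> - w)" for w
  proof -
    have "continuous_on UNIV (\<lambda>r. (r, w))" by (intro continuous_intros)
    from continuous_on_compose2[OF \<psi>_cont this] have "continuous_on UNIV (\<lambda>r. \<psi> r w)"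
      by simp
    then have cont: "continuous_on {r1..r2} (\<lambda>r. \<psi> r w)"
      by (rule continuous_on_subset) simp
    have "(\<integral>r. indicator {r1..r2} r *\<^sub>R \<psi> r w \<partial>lborel) = \<rho> (\<gamma> r2 \<odot> - w) - \<rho> (\<gamma> r1 \<odot> - w)"
      by (rule integral_FTC_atLeastAtMost[OF r has_vector_derivative_at_within[OF
            \<rho>_deriv[unfolded has_real_derivative_iff_has_vector_derivative]] cont])
    then show ?thesis by (simp add: right_diff_distrib)
  qed
  have inner: "(\<integral>w. ?F w r \<partial>lborel) = indicator {r1..r2} r *
      ((\<integral>w. \<rho> (\<gamma> r \<odot> - w) \<partial>M1) - (\<integral>w. \<rho> (\<gamma> r \<odot> - w) \<partial>M2))" for r
  proof -
    have "(\<integral>w. f w * \<psi> r w \<partial>lborel) = - (\<integral>w. f w * horizontal_derivative a b (\<lambda>w. \<rho> (\<gamma> r \<odot> - w)) w \<partial>lborel)"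
      by (simp add: H)
    also have "\<dots> = (\<integral>w. \<rho> (\<gamma> r \<odot> - w) \<partial>M1) - (\<integral>w. \<rho> (\<gamma> r \<odot> - w) \<partial>M2)"
      by (simp add: weak[OF test_function_translate[OF \<rho>]])
    finally show ?thesis by (simp add: mult.left_commute[of "f _"])
  qed
  have "mollify \<rho> f (\<gamma> r2) - mollify \<rho> f (\<gamma> r1) = (\<integral>w. \<integral>r. ?F w r \<partial>lborel \<partial>lborel)"
    unfolding FTC mollify_def
    by (rule Bochner_Integration.integral_diff[OF integrable_kernel integrable_kernel, symmetric])
  also have "\<dots> = (\<integral>r. \<integral>w. ?F w r \<partial>lborel \<partial>lborel)"
    by (rule lborel_pair.Fubini_integral[OF F_int, symmetric])
  finally have "ennreal \<bar>mollify \<rho> f (\<gamma> r2) - mollify \<rho> f (\<gamma> r1)\<bar> = ennreal \<bar>\<integral>r. \<integral>w. ?F w r \<partial>lborel \<partial>lborel\<bar>"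
    by simp
  also have "\<dots> \<le> (\<integral>\<^sup>+r. ennreal \<bar>\<integral>w. ?F w r \<partial>lborel\<bar> \<partial>lborel)"
    using integral_norm_bound_ennreal[OF lborel_pair.integrable_snd[OF F_int]] by simp
  also have "\<dots> \<le> (\<integral>\<^sup>+r. G (\<gamma> r) * indicator {r1..r2} r \<partial>lborel)"
  proof (rule nn_integral_mono)
    fix r
    \<comment> \<open>For a non-integrable integrand the Bochner integral is 0 by convention and the
      bound is trivial.\<close>
    have le: "ennreal \<bar>\<integral>w. \<rho> (\<gamma> r \<odot> - w) \<partial>M\<bar> \<le> (\<integral>\<^sup>+w. ennreal (\<rho> (\<gamma> r \<odot> - w)) \<partial>M)" for M
      using Bochner_Integration.integral_norm_bound_ennreal[of M "\<lambda>w. \<rho> (\<gamma> r \<odot> - w)"] \<rho>_nonneg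
      by (cases "integrable M (\<lambda>w. \<rho> (\<gamma> r \<odot> - w))") (auto simp: not_integrable_integral_eq)
    have "ennreal \<bar>(\<integral>w. \<rho> (\<gamma> r \<odot> - w) \<partial>M1) - (\<integral>w. \<rho> (\<gamma> r \<odot> - w) \<partial>M2)\<bar>
      \<le> ennreal \<bar>\<integral>w. \<rho> (\<gamma> r \<odot> - w) \<partial>M1\<bar> + ennreal \<bar>\<integral>w. \<rho> (\<gamma> r \<odot> - w) \<partial>M2\<bar>"
      by (auto simp flip: ennreal_plus intro!: ennreal_leI)
    also have "\<dots> \<le> G (\<gamma> r)" unfolding G_def by (intro add_mono le)
    finally show "ennreal \<bar>\<integral>w. ?F w r \<partial>lborel\<bar> \<le> G (\<gamma> r) * indicator {r1..r2} r"
      unfolding inner by (auto simp: indicator_def)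
  qed
  finally show ?thesis by (simp add: \<gamma>_def)
qed

end

subsection \<open>Functions of bounded variation\<close>

text \<open>Each one-variable \<open>deriv\<close> is the Frechet derivative in a coordinate
  direction, by the chain rule along a coordinate line. Linearity combines the two directions of
  each field.\<close>

lemma X_field_eq_horizontal_derivative:
  assumes "test_function \<phi>"
  shows "X_field \<phi> = horizontal_derivative 1 0 \<phi>" "Y_field \<phi> = horizontal_derivative 0 1 \<phi>"
proof -
  have C1: "C_k (Suc 0) \<phi>" using assms unfolding test_function_def by blast
  let ?D = "\<lambda>z. frechet_derivative \<phi> (at z)"
  note D = C_k_has_derivative[OF C1]
  note lin = C_k_derivative_linear[OF C1]
  have slice: "deriv (\<lambda>s. \<phi> (\<sigma> s)) r = ?D (\<sigma> r) v"
    if \<sigma>: "(\<sigma> has_derivative (\<lambda>h. h *\<^sub>R v)) (at r)" for \<sigma> r v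
  proof (rule DERIV_imp_deriv)
    have "?D z (h *\<^sub>R v) = ?D z v * h" for z h
      using linear_scale[OF lin] by simp
    then show "((\<lambda>s. \<phi> (\<sigma> s)) has_real_derivative ?D (\<sigma> r) v) (at r)"
      using has_derivative_compose[OF \<sigma> D] unfolding has_field_derivative_def by (simp only:)
  qed
  have x: "deriv (\<lambda>s. \<phi> (s, y, t)) x = ?D (x, y, t) (1, 0, 0)" for x y t
    by (rule slice) (auto intro!: derivative_eq_intros simp: fun_eq_iff zero_prod_def)
  have y: "deriv (\<lambda>s. \<phi> (x, s, t)) y = ?D (x, y, t) (0, 1, 0)" for x y t
    by (rule slice) (auto intro!: derivative_eq_intros simp: fun_eq_iff zero_prod_def)
  have t: "deriv (\<lambda>s. \<phi> (x, y, s)) t = ?D (x, y, t) (0, 0, 1)" for x y t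
    by (rule slice) (auto intro!: derivative_eq_intros simp: fun_eq_iff zero_prod_def)
  show "X_field \<phi> = horizontal_derivative 1 0 \<phi>"
  proof
    fix p :: heis
    obtain a b c where p: "p = (a, b, c)" by (cases p rule: prod_cases3)
    show "X_field \<phi> p = horizontal_derivative 1 0 \<phi> p"
      using linear_add[OF lin[of p], of "(1, 0, 0)" "(- b / 2) *\<^sub>R (0, 0, 1)"]
        linear_scale[OF lin[of p], of "- b / 2" "(0, 0, 1)"]
      by (simp add: p X_field_def horizontal_derivative_def x t)
  qed
  show "Y_field \<phi> = horizontal_derivative 0 1 \<phi>"
  proof
    fix p :: heis
    obtain a b c where p: "p = (a, b, c)" by (cases p rule: prod_cases3)
    show "Y_field \<phi> p = horizontal_derivative 0 1 \<phi> p"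
      using linear_add[OF lin[of p], of "(0, 1, 0)" "(a / 2) *\<^sub>R (0, 0, 1)"]
        linear_scale[OF lin[of p], of "a / 2" "(0, 0, 1)"]
      by (simp add: p Y_field_def horizontal_derivative_def y t)
  qed
qed

lemma horizontal_derivative_measurable:
  assumes "test_function \<phi>"
  shows "horizontal_derivative a b \<phi> \<in> borel_measurable borel"
proof -
  have C1: "C_k (Suc 0) \<phi>" using assms unfolding test_function_def by blast
  have "continuous_on UNIV (\<lambda>w. horizontal_derivative a b \<phi> w)"
    unfolding horizontal_derivative_def
    by (intro continuous_on_C_k_derivative[OF C1] continuous_intros) simp_all
  then show ?thesis by (rule borel_measurable_continuous_onI)
qed

section \<open>Jordan parts and total variation\<close>

lemma abs_le_total_variation:
  fixes \<nu> :: "'a::topological_space set \<Rightarrow> real"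
  assumes B: "B \<in> sets borel"
  shows "ennreal \<bar>\<nu> B\<bar> \<le> total_variation \<nu>"
proof -
  \<comment> \<open>The partition consists of B, its complement and then empty sets; the single term
    of index 0 gives the bound.\<close>
  define A where "A = binaryset B (- B)"
  have "ennreal \<bar>\<nu> B\<bar> = (\<Sum>i\<in>{0}. ennreal \<bar>\<nu> (A i)\<bar>)"
    by (simp add: A_def binaryset_def)
  also have "\<dots> \<le> (\<Sum>i. ennreal \<bar>\<nu> (A i)\<bar>)"
    by (rule sum_le_suminf) auto
  also have "\<dots> \<le> total_variation \<nu>"
    unfolding total_variation_def
    by (rule SUP_upper)
      (use B in \<open>auto simp: A_def range_binaryset_eq UN_binaryset_eq disjoint_family_on_def binaryset_def\<close>)
  finally show ?thesis .
qed

text \<open>\<open>measure_of\<close> returns the zero measure unless the set function is countably additive, so the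
  bound below holds without establishing the Jordan decomposition.\<close>

lemma positive_part_mass:
  fixes \<nu> :: "'a::topological_space set \<Rightarrow> real"
  shows "sets (positive_part \<nu>) = sets borel" "space (positive_part \<nu>) = UNIV"
    "emeasure (positive_part \<nu>) UNIV \<le> total_variation \<nu>"
proof -
  show "sets (positive_part \<nu>) = sets borel"
    using sets.sigma_sets_eq[of "borel :: 'a measure"] by (simp add: positive_part_def)
  show "space (positive_part \<nu>) = UNIV" by (simp add: positive_part_def space_measure_of_conv)
  have "ennreal (\<nu> B) \<le> total_variation \<nu>" if "B \<in> sets borel" for B
    using abs_le_total_variation[OF that, of \<nu>] by (meson abs_ge_self ennreal_leI order_trans)
  then show "emeasure (positive_part \<nu>) UNIV \<le> total_variation \<nu>"
    by (auto simp: positive_part_def emeasure_measure_of_conv intro!: SUP_least)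
qed

lemma positive_part_finite:
  fixes \<nu> :: "'a::topological_space set \<Rightarrow> real"
  shows "total_variation \<nu> < \<infinity> \<Longrightarrow> finite_measure (positive_part \<nu>)"
  using positive_part_mass[of \<nu>] by (intro finite_measureI) (auto simp: top_unique)

lemma total_variation_uminus: "total_variation (\<lambda>A. - \<nu> A) = total_variation \<nu>"
  by (simp add: total_variation_def)

section \<open>Removal of the mollification\<close>

text \<open>Mollification does not increase the masses of the derivatives, so the bound holds
  uniformly for the approximants. They converge to f in L^1, hence almost everywhere along a
  subsequence, and Fatou's lemma transfers the bound to f.\<close>

lemma horizontal_Sobolev:
  fixes f :: "heis \<Rightarrow> real"
  assumes f: "integrable lborel f"
    and M: "finite_measure M1" "sets M1 = sets borel" "finite_measure M2" "sets M2 = sets borel"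
    and N: "finite_measure N1" "sets N1 = sets borel" "finite_measure N2" "sets N2 = sets borel"
    and weakX: "\<And>\<phi>. test_function \<phi> \<Longrightarrow>
      (\<integral>w. f w * horizontal_derivative 1 0 \<phi> w \<partial>lborel) = - ((\<integral>w. \<phi> w \<partial>M1) - (\<integral>w. \<phi> w \<partial>M2))"
    and weakY: "\<And>\<phi>. test_function \<phi> \<Longrightarrow>
      (\<integral>w. f w * horizontal_derivative 0 1 \<phi> w \<partial>lborel) = - ((\<integral>w. \<phi> w \<partial>N1) - (\<integral>w. \<phi> w \<partial>N2))"
    and X: "X > 0" "emeasure M1 UNIV + emeasure M2 UNIV \<le> ennreal X"
    and Y: "Y > 0" "emeasure N1 UNIV + emeasure N2 UNIV \<le> ennreal Y"
  shows "(\<integral>\<^sup>+p. ennreal (\<bar>f p\<bar> powr (4 / 3)) \<partial>lborel) \<le> ennreal (144 * (X * Y) powr (2 / 3))"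
proof -
  have f_meas[measurable]: "f \<in> borel_measurable borel" using borel_measurable_integrable[OF f] by simp
  define approx where "approx n u \<longleftrightarrow> continuous_on UNIV u \<and> (\<integral>\<^sup>+p. ennreal \<bar>u p\<bar> \<partial>lborel) \<noteq> \<infinity> \<and>
      (\<integral>\<^sup>+p. ennreal \<bar>u p - f p\<bar> \<partial>lborel) \<le> ennreal (1 / Suc n) \<and>
      (\<integral>\<^sup>+p. ennreal (\<bar>u p\<bar> powr (4 / 3)) \<partial>lborel) \<le> ennreal (144 * (X * Y) powr (2 / 3))"
    for n :: nat and u :: "heis \<Rightarrow> real"
  have "\<exists>u. approx n u" for n
  proof -
    obtain d where d: "d > 0"
      "\<And>q. norm q < d \<Longrightarrow> (\<integral>\<^sup>+p. ennreal \<bar>f (q \<odot> p) - f p\<bar> \<partial>lborel) \<le> ennreal (1 / Suc n)"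
      by (rule translation_continuousD[OF integrable_translation_continuous[OF f], of "1 / Suc n"]) auto
    obtain \<rho> :: "heis \<Rightarrow> real" where \<rho>: "test_function \<rho>" "\<And>q. \<rho> q \<ge> 0" "\<And>q. \<rho> q \<noteq> 0 \<Longrightarrow> norm q < d"
        "(\<integral>\<^sup>+q. ennreal (\<rho> q) \<partial>lborel) = 1"
      by (rule mollifier_exists[OF d(1)]) blast
    interpret X: mollified_derivative f \<rho> 1 0 M1 M2
      by (intro mollified_derivative.intro mollification.intro mollified_derivative_axioms.intro f \<rho> M weakX)
    interpret Y: mollified_derivative f \<rho> 0 1 N1 N2
      by (intro mollified_derivative.intro mollification.intro mollified_derivative_axioms.intro f \<rho> N weakY)
    interpret U: horizontal_upper_gradients "mollify \<rho> f" X.G Y.G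
    proof
      \<comment> \<open>The X-line with label (y, t) is the integral line through (0, y, t), since
        (0, y, t) \<odot> (r, 0, 0) = (r, y, t - r y/2).\<close>
      show "ennreal \<bar>mollify \<rho> f (b, y, t - b * y / 2) - mollify \<rho> f (a, y, t - a * y / 2)\<bar>
        \<le> (\<integral>\<^sup>+r. X.G (r, y, t - r * y / 2) * indicator {a..b} r \<partial>lborel)" if "a \<le> b" for y t a b
        using X.mollify_upper_gradient[OF that, of "(0, y, t)"] by (simp add: mult.commute[of y])
      show "ennreal \<bar>mollify \<rho> f (x, b, t + x * b / 2) - mollify \<rho> f (x, a, t + x * a / 2)\<bar>
        \<le> (\<integral>\<^sup>+r. Y.G (x, r, t + x * r / 2) * indicator {a..b} r \<partial>lborel)" if "a \<le> b" for x t a b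
        using Y.mollify_upper_gradient[OF that, of "(x, 0, t)"] by simp
    qed (fact X.mollify_continuous X.mollify_L1 X.G_measurable Y.G_measurable)+
    have "approx n (mollify \<rho> f)"
      unfolding approx_def
    proof (intro conjI)
      show "(\<integral>\<^sup>+p. ennreal \<bar>mollify \<rho> f p - f p\<bar> \<partial>lborel) \<le> ennreal (1 / Suc n)"
        using d(2)[of "- _"] \<rho>(3) by (intro X.mollify_approx) auto
      show "(\<integral>\<^sup>+p. ennreal (\<bar>mollify \<rho> f p\<bar> powr (4 / 3)) \<partial>lborel) \<le> ennreal (144 * (X * Y) powr (2 / 3))"
        using X Y by (intro U.Sobolev_inequality) (simp_all add: X.G_mass Y.G_mass)
    qed (fact X.mollify_continuous X.mollify_L1)+
    then show ?thesis by blast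
  qed
  then obtain u where "\<And>n. approx n (u n)" by metis
  then have u: "\<And>n. continuous_on UNIV (u n)" "\<And>n. (\<integral>\<^sup>+p. ennreal \<bar>u n p\<bar> \<partial>lborel) \<noteq> \<infinity>"
      "\<And>n. (\<integral>\<^sup>+p. ennreal \<bar>u n p - f p\<bar> \<partial>lborel) \<le> ennreal (1 / Suc n)"
      "\<And>n. (\<integral>\<^sup>+p. ennreal (\<bar>u n p\<bar> powr (4 / 3)) \<partial>lborel) \<le> ennreal (144 * (X * Y) powr (2 / 3))"
    unfolding approx_def by blast+
  have [measurable]: "u n \<in> borel_measurable borel" for n
    by (rule borel_measurable_continuous_onI[OF u(1)])
  have "integrable lborel (u n)" for n
    using u(2)[of n] by (intro integrableI_bounded) (auto simp: less_top)
  then have int: "integrable lborel (\<lambda>p. u n p - f p)" for n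
    using f by (rule Bochner_Integration.integrable_diff)
  have "(\<integral>p. norm (u n p - f p) \<partial>lborel) \<le> 1 / Suc n" for n
    using u(3)[of n] by (subst integral_eq_nn_integral) (auto intro!: enn2real_leI)
  then have "(\<lambda>n. \<integral>p. norm (u n p - f p) \<partial>lborel) \<longlonglongrightarrow> 0"
    by (intro tendsto_sandwich[OF _ _ tendsto_const LIMSEQ_Suc[OF lim_1_over_n]]) auto
  from tendsto_L1_AE_subseq[OF int this] obtain r where
    r: "AE p in lborel. (\<lambda>n. u (r n) p - f p) \<longlonglongrightarrow> 0" by blast
  have "(\<integral>\<^sup>+p. ennreal (\<bar>f p\<bar> powr (4 / 3)) \<partial>lborel)
    = (\<integral>\<^sup>+p. liminf (\<lambda>n. ennreal (\<bar>u (r n) p\<bar> powr (4 / 3))) \<partial>lborel)"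
  proof (rule nn_integral_cong_AE, use r in eventually_elim)
    case (elim p)
    then have "(\<lambda>n. u (r n) p) \<longlonglongrightarrow> f p" by (simp add: LIM_zero_iff)
    then have "(\<lambda>n. ennreal (\<bar>u (r n) p\<bar> powr (4 / 3))) \<longlonglongrightarrow> ennreal (\<bar>f p\<bar> powr (4 / 3))"
      by (intro tendsto_ennrealI tendsto_powr' tendsto_rabs tendsto_const) auto
    from lim_imp_Liminf[OF sequentially_bot this] show ?case by simp
  qed
  also have "\<dots> \<le> liminf (\<lambda>n. \<integral>\<^sup>+p. ennreal (\<bar>u (r n) p\<bar> powr (4 / 3)) \<partial>lborel)"
    by (rule nn_integral_liminf) measurable
  also have "\<dots> \<le> ennreal (144 * (X * Y) powr (2 / 3))"
    by (rule Liminf_le) (auto simp: u(4))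
  finally show ?thesis .
qed

section \<open>Borel representatives and conclusion\<close>

text \<open>A BV function is only Lebesgue measurable, whereas the mollification argument concerns
  Borel functions and \<open>lborel\<close>. Changing f on a null set does not affect its pairing
  with test functions.\<close>

lemma weak_derivative_borel_representative:
  assumes "integrable lebesgue f" and g[measurable]: "g \<in> borel_measurable borel"
    and fg: "AE p in lebesgue. f p = g p"
    and "measure_derivative Z f \<nu>" "\<And>\<phi>. test_function \<phi> \<Longrightarrow> Z \<phi> = horizontal_derivative a b \<phi>"
    and \<phi>: "test_function \<phi>"
  shows "(\<integral>w. g w * horizontal_derivative a b \<phi> w \<partial>lborel)
    = - ((\<integral>w. \<phi> w \<partial>positive_part \<nu>) - (\<integral>w. \<phi> w \<partial>positive_part (\<lambda>A. - \<nu> A)))"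
proof -
  have [measurable]: "horizontal_derivative a b \<phi> \<in> borel_measurable borel"
    by (rule horizontal_derivative_measurable[OF \<phi>])
  have [measurable]: "f \<in> borel_measurable lebesgue" using assms(1) by simp
  have "(\<integral>w. g w * horizontal_derivative a b \<phi> w \<partial>lborel) = (\<integral>w. g w * horizontal_derivative a b \<phi> w \<partial>lebesgue)"
    by (rule integral_completion[symmetric]) measurable
  also have "\<dots> = (\<integral>w. f w * horizontal_derivative a b \<phi> w \<partial>lebesgue)"
  proof (rule integral_cong_AE)
    have "(\<lambda>w. g w) \<in> borel_measurable lebesgue" "(\<lambda>w. horizontal_derivative a b \<phi> w) \<in> borel_measurable lebesgue"
      by (simp_all add: measurable_completion)
    then show "(\<lambda>w. g w * horizontal_derivative a b \<phi> w) \<in> borel_measurable lebesgue"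
      "(\<lambda>w. f w * horizontal_derivative a b \<phi> w) \<in> borel_measurable lebesgue"
      by (auto intro!: borel_measurable_times)
    show "AE w in lebesgue. g w * horizontal_derivative a b \<phi> w = f w * horizontal_derivative a b \<phi> w"
      using fg by eventually_elim simp
  qed
  also have "\<dots> = - signed_integral \<nu> \<phi>"
    using assms(4,5) \<phi> by (auto simp: measure_derivative_def)
  finally show ?thesis by (simp add: signed_integral_def)
qed

text \<open>The factor 2 comes from bounding the mass of each of the two Jordan parts by the full
  total variation.\<close>

lemma BV_heis_power_integral_le:
  assumes "integrable lebesgue f" "measure_derivative X_field f Xf" "measure_derivative Y_field f Yf"
    and X: "2 * enn2real (total_variation Xf) \<le> X" "X > 0" and Y: "2 * enn2real (total_variation Yf) \<le> Y" "Y > 0"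
  shows "(\<integral>\<^sup>+p. ennreal (\<bar>f p\<bar> powr (4 / 3)) \<partial>lebesgue) \<le> ennreal (144 * (X * Y) powr (2 / 3))"
proof -
  have fin: "total_variation Xf < \<infinity>" "total_variation Yf < \<infinity>"
    using assms(2,3) by (auto simp: measure_derivative_def)
  have mass: "emeasure (positive_part \<nu>) UNIV + emeasure (positive_part (\<lambda>A. - \<nu> A)) UNIV \<le> ennreal B"
    if "2 * enn2real (total_variation \<nu>) \<le> B" "total_variation \<nu> < \<infinity>" for \<nu> :: "heis set \<Rightarrow> real" and B
  proof -
    have "emeasure (positive_part \<nu>) UNIV + emeasure (positive_part (\<lambda>A. - \<nu> A)) UNIV
        \<le> total_variation \<nu> + total_variation \<nu>"
      using positive_part_mass(3)[of \<nu>] positive_part_mass(3)[of "\<lambda>A. - \<nu> A"]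
      by (intro add_mono) (simp_all add: total_variation_uminus)
    also have "\<dots> \<le> ennreal B"
      using that by (cases "total_variation \<nu>") (auto simp flip: ennreal_plus intro!: ennreal_leI)
    finally show ?thesis .
  qed
  obtain g where g[measurable]: "g \<in> borel_measurable borel" and "AE p in lborel. f p = g p"
    using completion_ex_borel_measurable_real[of f lborel] assms(1) by auto
  then have fg: "AE p in lebesgue. f p = g p" by (intro AE_completion)
  have "integrable lebesgue g"
    using assms(1) fg integrable_cong_AE_imp[of lebesgue f g] by (simp add: measurable_completion eq_commute)
  then have "integrable lborel g" by (simp add: integrable_completion)
  have "(\<integral>\<^sup>+p. ennreal (\<bar>f p\<bar> powr (4 / 3)) \<partial>lebesgue) = (\<integral>\<^sup>+p. ennreal (\<bar>g p\<bar> powr (4 / 3)) \<partial>lebesgue)"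
    by (rule nn_integral_cong_AE) (use fg in eventually_elim, simp)
  also have "\<dots> = (\<integral>\<^sup>+p. ennreal (\<bar>g p\<bar> powr (4 / 3)) \<partial>lborel)" by (rule nn_integral_completion)
  also have "\<dots> \<le> ennreal (144 * (X * Y) powr (2 / 3))"
  proof (rule horizontal_Sobolev)
    show "(\<integral>w. g w * horizontal_derivative 1 0 \<phi> w \<partial>lborel)
        = - ((\<integral>w. \<phi> w \<partial>positive_part Xf) - (\<integral>w. \<phi> w \<partial>positive_part (\<lambda>A. - Xf A)))" if "test_function \<phi>" for \<phi>
      by (rule weak_derivative_borel_representative[OF assms(1) g fg assms(2) X_field_eq_horizontal_derivative(1) that])
    show "(\<integral>w. g w * horizontal_derivative 0 1 \<phi> w \<partial>lborel)
        = - ((\<integral>w. \<phi> w \<partial>positive_part Yf) - (\<integral>w. \<phi> w \<partial>positive_part (\<lambda>A. - Yf A)))" if "test_function \<phi>" for \<phi>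
      by (rule weak_derivative_borel_representative[OF assms(1) g fg assms(3) X_field_eq_horizontal_derivative(2) that])
    show "emeasure (positive_part Xf) UNIV + emeasure (positive_part (\<lambda>A. - Xf A)) UNIV \<le> ennreal X"
      by (rule mass[OF X(1) fin(1)])
    show "emeasure (positive_part Yf) UNIV + emeasure (positive_part (\<lambda>A. - Yf A)) UNIV \<le> ennreal Y"
      by (rule mass[OF Y(1) fin(2)])
  qed (use fin \<open>integrable lborel g\<close> X(2) Y(2) in
      \<open>simp_all add: positive_part_mass positive_part_finite total_variation_uminus\<close>)
  finally show ?thesis .
qed

theorem theorem1p8:
  shows "\<exists>C::real. C \<ge> 1 \<and>
    (\<forall>f\<in>BV_heis. \<forall>Xf Yf. measure_derivative X_field f Xf \<longrightarrow> measure_derivative Y_field f Yf \<longrightarrow>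
       Lp_norm (4 / 3) f
         \<le> ennreal (C * sqrt (enn2real (total_variation Xf) * enn2real (total_variation Yf))))"
proof (intro exI[of _ "144 powr (3 / 4) * 2"] conjI ballI allI impI)
  \<comment> \<open>The constant is 144^(3/4), from taking the root of order 4/3, times the 2 that
    remains of sqrt ((2 a) (2 b)).\<close>
  have "1 \<le> (144::real) powr (3 / 4)" by (rule ge_one_powr_ge_zero) auto
  then show "1 \<le> (144::real) powr (3 / 4) * 2" by simp
  fix f Xf Yf
  assume f: "f \<in> BV_heis" and D: "measure_derivative X_field f Xf" "measure_derivative Y_field f Yf"
  define a b where "a = enn2real (total_variation Xf)" and "b = enn2real (total_variation Yf)"
  have ab: "a \<ge> 0" "b \<ge> 0" by (simp_all add: a_def b_def)
  define I where "I = (\<integral>\<^sup>+p. ennreal (\<bar>f p\<bar> powr (4 / 3)) \<partial>lebesgue)"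
  \<comment> \<open>The layer argument divides by positive bounds on the masses, while a total
    variation may be 0; hence the perturbation by \<delta> and the limit.\<close>
  have I: "I \<le> ennreal (144 * ((2 * a) * (2 * b)) powr (2 / 3))"
  proof (rule tendsto_lowerbound)
    show "((\<lambda>\<delta>. ennreal (144 * ((2 * a + \<delta>) * (2 * b + \<delta>)) powr (2 / 3))) \<longlongrightarrow>
        ennreal (144 * ((2 * a) * (2 * b)) powr (2 / 3))) (at_right 0)"
    proof (intro tendsto_ennrealI tendsto_mult tendsto_const)
      have "((\<lambda>\<delta>. (2 * a + \<delta>) * (2 * b + \<delta>)) \<longlongrightarrow> (2 * a + 0) * (2 * b + 0)) (at_right 0)"
        by (intro tendsto_intros)
      then show "((\<lambda>\<delta>. ((2 * a + \<delta>) * (2 * b + \<delta>)) powr (2 / 3)) \<longlongrightarrow> ((2 * a) * (2 * b)) powr (2 / 3)) (at_right 0)"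
        by (intro tendsto_powr') (use ab in \<open>auto simp: eventually_at_filter\<close>)
    qed
    show "\<forall>\<^sub>F \<delta> in at_right 0. I \<le> ennreal (144 * ((2 * a + \<delta>) * (2 * b + \<delta>)) powr (2 / 3))"
      unfolding eventually_at_filter I_def
    proof (intro always_eventually allI impI)
      fix \<delta> :: real assume "\<delta> \<in> {0<..}"
      then have "2 * a + \<delta> > 0" "2 * b + \<delta> > 0" "\<delta> > 0" using ab by (auto intro: add_nonneg_pos)
      moreover have "integrable lebesgue f" using f by (simp add: BV_heis_def)
      ultimately show "(\<integral>\<^sup>+p. ennreal (\<bar>f p\<bar> powr (4 / 3)) \<partial>lebesgue)
          \<le> ennreal (144 * ((2 * a + \<delta>) * (2 * b + \<delta>)) powr (2 / 3))"
        by (intro BV_heis_power_integral_le[OF _ D]) (auto simp: a_def b_def)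
    qed
  qed simp
  \<comment> \<open>Finiteness selects the branch of \<open>Lp_norm\<close> in which the root is
    taken.\<close>
  then have "I \<noteq> \<infinity>" by (auto simp: top_unique)
  then have "Lp_norm (4 / 3) f = ennreal (enn2real I powr (3 / 4))"
    by (simp add: Lp_norm_def I_def Let_def)
  also have "\<dots> \<le> ennreal ((144 * ((2 * a) * (2 * b)) powr (2 / 3)) powr (3 / 4))"
    using I by (intro ennreal_leI powr_mono2) (auto intro: enn2real_leI)
  also have "(144 * ((2 * a) * (2 * b)) powr (2 / 3)) powr (3 / 4) = 144 powr (3 / 4) * 2 * sqrt (a * b)"
  proof -
    have "(((2 * a) * (2 * b)) powr (2 / 3)) powr (3 / 4) = sqrt ((2 * a) * (2 * b))"
      using ab by (simp add: powr_powr powr_half_sqrt)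
    also have "\<dots> = 2 * sqrt (a * b)"
      by (simp add: real_sqrt_mult)
    finally show ?thesis by (simp add: powr_mult)
  qed
  finally show "Lp_norm (4 / 3) f
      \<le> ennreal (144 powr (3 / 4) * 2 * sqrt (enn2real (total_variation Xf) * enn2real (total_variation Yf)))"
    by (simp add: a_def b_def)
qed

end
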